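(* Let $f(\zeta,t)$ be a locally univalent solution of the L\"owner-Kufarev equation $\dot f=\zeta f'P$ (Hele-Shaw flow), with $g=f'$ rational of the form $$g(\zeta,t)=b(t)\frac{\prod_{k=1}^{m}(\zeta-\omega_k(t))}{\prod_{j=1}^{n}(\zeta-\zeta_j(t))}=b(t)\frac{\prod_{k=1}^{m}(\zeta-\omega_k(t))}{\prod_{j=1}^{\ell}(\zeta-\zeta_j(t))^{n_j}},$$ and let $P(\zeta,t)$ also denote the rational function of $\zeta$ extending $P$ beyond the unit disk. Then the zeros and poles of $g$ evolve according to $$\dot\omega_k(t)=-\operatorname{Res}_{\zeta=\omega_k}\left[\zeta P(\zeta,t)\frac{g'(\zeta,t)}{g(\zeta,t)}\right],\qquad \dot\zeta_j(t)=\operatorname{Res}_{\zeta=\zeta_j}\left[\zeta P(\zeta,t)\frac{g'(\zeta,t)}{g(\zeta,t)}\right],$$ valid whenever $\omega_k$, respectively $\zeta_j$, is a simple zero, respectively simple pole, of $g$. If $\omega_k$ is a multiple zero of $g$ (at the time $t$ considered), and $K\subset\{1,\dots,m\}$ is the set of indices $i$ with $\omega_i(t)=\omega_k(t)$, then the individual derivative $\dot\omega_k(t)$ need not exist, but $$\frac{d}{dt}\sum_{i\in K}\omega_i(t)=-\operatorname{Res}_{\zeta=\omega_k}\left[\zeta P(\zeta,t)\frac{g'(\zeta,t)}{g(\zeta,t)}\right].$$ For multiple poles the derivatives $\dot\zeta_j$ do exist, and $$n_j\dot\zeta_j(t)=\operatorname{Res}_{\zeta=\zeta_j}\left[\zeta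 P(\zeta,t)\frac{g'(\zeta,t)}{g(\zeta,t)}\right]\qquad(1\le j\le \ell).$$
   Context: Notation: $\mathbb{D}$ is the open unit disk; dot denotes $\partial/\partial t$ and prime denotes $\partial/\partial\zeta$. Locally univalent solution: for $t$ in a time interval, $f(\cdot,t)$ is analytic in a neighborhood of $\overline{\mathbb{D}}$, $f(0,t)=0$, $f'(0,t)>0$, $f'(\zeta,t)\neq0$ for $\zeta\in\overline{\mathbb{D}}$, $f$ depends smoothly on $t$, and the Polubarinova-Galin equation $\operatorname{Re}[\dot f(\zeta,t)\overline{\zeta f'(\zeta,t)}]=q(t)$ holds for $\zeta\in\partial\mathbb{D}$, where $q$ is a given real-valued continuous function. Equivalently, the L\"owner-Kufarev equation $\dot f(\zeta,t)=\zeta f'(\zeta,t)P(\zeta,t)$ holds for $\zeta\in\mathbb{D}$, with $$P(\zeta,t)=\frac{1}{2\pi i}\int_{\partial\mathbb{D}}\frac{q(t)}{|f'(z,t)|^2}\,\frac{z+\zeta}{z-\zeta}\,\frac{dz}{z}.$$ Form of $g=f'$: $m\ge n$; $b(t)\neq0$; $|\omega_k|>1$ and $|\zeta_j|>1$; zeros and poles are repeated according to multiplicity (no zero coincides with a pole), with $\omega_k(t)$ depending continuously on $t$. The poles $\zeta_1,\dots,\zeta_\ell$ are distinct with orders $n_j\ge1$, $\sum_{j=1}^\ell n_j=n$, and $\zeta_{\ell+1},\dots,\zeta_n$ are repetitions of these. The numbers $m,n,\ell,n_j$ are fixed on the time interval considered. When $g$ is rational, $P(\cdot,t)|_{\mathbb{D}}$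 is the restriction of a rational function, also denoted $P(\cdot,t)$.
   Formalization: The labelled distinct poles ζ_1,…,ζ_ℓ are assumed to depend continuously on t, like the ω_k; otherwise two poles of equal order could exchange labels at some time and ζ_j would not be differentiable. *)

theory Defs
  imports "HOL-Complex_Analysis.Complex_Analysis"
begin

text \<open>
  Functions of space and time are curried as \<open>f z t\<close>. The prime (complex derivative in space) is
  \<^const>\<open>deriv\<close> applied to \<open>\<lambda>z. f z t\<close>; the dot is the derivative relative to the time interval \<open>I\<close>,
  hence one-sided at an end point that belongs to \<open>I\<close> and two-sided in the interior.
\<close>

definition tderiv :: "real set \<Rightarrow> (complex \<Rightarrow> real \<Rightarrow> complex) \<Rightarrow> complex \<Rightarrow> real \<Rightarrow> complex" where
  "tderiv I f z t = vector_derivative (\<lambda>s. f z s) (at t within I)"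

text \<open>
  Since \<open>q\<close> is only continuous, smooth dependence on \<open>t\<close> can only mean continuous
  differentiability; here it is required on the closed unit disk, jointly in both variables.
\<close>

definition smooth_in_time :: "real set \<Rightarrow> (complex \<Rightarrow> real \<Rightarrow> complex) \<Rightarrow> bool" where
  "smooth_in_time I f \<longleftrightarrow>
     (\<forall>z\<in>cball 0 1. \<forall>t\<in>I. (\<lambda>s. f z s) differentiable (at t within I)) \<and>
     continuous_on (cball 0 1 \<times> I) (\<lambda>(z, t). tderiv I f z t)"

text \<open>The last conjunct is the Polubarinova-Galin equation.\<close>

definition locally_univalent_solution ::
    "real set \<Rightarrow> (real \<Rightarrow> real) \<Rightarrow> (complex \<Rightarrow> real \<Rightarrow> complex) \<Rightarrow> bool" where
  "locally_univalent_solution I q f \<longleftrightarrow>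
     is_interval I \<and> interior I \<noteq> {} \<and>
     continuous_on I q \<and>
     (\<forall>t\<in>I. (\<lambda>z. f z t) analytic_on cball 0 1 \<and>
            f 0 t = 0 \<and>
            Im (deriv (\<lambda>z. f z t) 0) = 0 \<and> Re (deriv (\<lambda>z. f z t) 0) > 0 \<and>
            (\<forall>z\<in>cball 0 1. deriv (\<lambda>w. f w t) z \<noteq> 0)) \<and>
     smooth_in_time I f \<and>
     (\<forall>t\<in>I. \<forall>z\<in>sphere 0 1. Re (tderiv I f z t * cnj (z * deriv (\<lambda>w. f w t) z)) = q t)"

definition LK_P :: "(real \<Rightarrow> real) \<Rightarrow> (complex \<Rightarrow> real \<Rightarrow> complex) \<Rightarrow> complex \<Rightarrow> real \<Rightarrow> complex" where
  "LK_P q f \<zeta> t =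
     1 / (2 * of_real pi * \<i>) *
     contour_integral (circlepath 0 1)
       (\<lambda>z. of_real (q t / (cmod (deriv (\<lambda>w. f w t) z))\<^sup>2) * ((z + \<zeta>) / (z - \<zeta>)) / z)"

text \<open>\<open>R\<close> is the rational function that extends the function \<open>P\<close> at time \<open>t\<close> beyond the unit disk.\<close>

definition rational_extension ::
    "(real \<Rightarrow> real) \<Rightarrow> (complex \<Rightarrow> real \<Rightarrow> complex) \<Rightarrow> real \<Rightarrow> (complex \<Rightarrow> complex) \<Rightarrow> bool" where
  "rational_extension q f t R \<longleftrightarrow>
     (\<exists>A B :: complex poly. B \<noteq> 0 \<and> (\<forall>z. R z = poly A z / poly B z)) \<and>
     (\<forall>z\<in>ball 0 1. R z = LK_P q f z t)"

definition rat_g :: "nat \<Rightarrow> nat \<Rightarrow> (real \<Rightarrow> complex) \<Rightarrow> (nat \<Rightarrow> real \<Rightarrow> complex) \<Rightarrow>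
    (nat \<Rightarrow> real \<Rightarrow> complex) \<Rightarrow> complex \<Rightarrow> real \<Rightarrow> complex" where
  "rat_g m n b \<omega> p z t = b t * (\<Prod>k=1..m. z - \<omega> k t) / (\<Prod>j=1..n. z - p j t)"

text \<open>
  The zeros are \<open>\<omega> 1, \<dots>, \<omega> m\<close> and the poles \<open>p 1, \<dots>, p n\<close>, repeated according to multiplicity.
  The poles \<open>p 1, \<dots>, p l\<close> are distinct, of orders \<open>\<nu> 1, \<dots>, \<nu> l\<close>; the counting conditions force
  \<open>p (l+1), \<dots>, p n\<close> to be repetitions of these. Continuity of the distinct poles only fixes
  their labelling: without it two poles of equal order could exchange their labels at any time.
\<close>

definition rational_derivative :: "real set \<Rightarrow> (complex \<Rightarrow> real \<Rightarrow> complex) \<Rightarrow> nat \<Rightarrow> nat \<Rightarrow> nat \<Rightarrow>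
    (nat \<Rightarrow> nat) \<Rightarrow> (real \<Rightarrow> complex) \<Rightarrow> (nat \<Rightarrow> real \<Rightarrow> complex) \<Rightarrow> (nat \<Rightarrow> real \<Rightarrow> complex) \<Rightarrow> bool"
  where
  "rational_derivative I f m n l \<nu> b \<omega> p \<longleftrightarrow>
     n \<le> m \<and>
     (\<forall>j\<in>{1..l}. 1 \<le> \<nu> j) \<and> (\<Sum>j=1..l. \<nu> j) = n \<and>
     (\<forall>k\<in>{1..m}. continuous_on I (\<omega> k)) \<and>
     (\<forall>j\<in>{1..l}. continuous_on I (p j)) \<and>
     (\<forall>t\<in>I.
        b t \<noteq> 0 \<and>
        (\<forall>k\<in>{1..m}. 1 < cmod (\<omega> k t)) \<and> (\<forall>j\<in>{1..n}. 1 < cmod (p j t)) \<and>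
        (\<forall>k\<in>{1..m}. \<forall>j\<in>{1..n}. \<omega> k t \<noteq> p j t) \<and>
        inj_on (\<lambda>j. p j t) {1..l} \<and>
        (\<forall>j\<in>{1..l}. card {i\<in>{1..n}. p i t = p j t} = \<nu> j) \<and>
        (\<forall>z\<in>cball 0 1. deriv (\<lambda>w. f w t) z = rat_g m n b \<omega> p z t))"

text \<open>The two displayed product forms of \<open>g\<close> agree.\<close>

lemma rat_g_distinct_poles:
  assumes "rational_derivative I f m n l \<nu> b \<omega> p" and "t \<in> I"
  shows "rat_g m n b \<omega> p z t = b t * (\<Prod>k=1..m. z - \<omega> k t) / (\<Prod>j=1..l. (z - p j t) ^ \<nu> j)"
proof -
  let ?C = "\<lambda>j. {i\<in>{1..n}. p i t = p j t}"
  note rd = assms(1)[unfolded rational_derivative_def]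
  have sum: "(\<Sum>j=1..l. \<nu> j) = n"
    using rd by blast
  have inj: "inj_on (\<lambda>j. p j t) {1..l}" and card: "\<And>j. j \<in> {1..l} \<Longrightarrow> card (?C j) = \<nu> j"
    using rd \<open>t \<in> I\<close> by blast+
  have disj: "\<forall>i\<in>{1..l}. \<forall>j\<in>{1..l}. i \<noteq> j \<longrightarrow> ?C i \<inter> ?C j = {}"
    using inj_onD[OF inj] by fastforce
  have "card (\<Union>j\<in>{1..l}. ?C j) = (\<Sum>j\<in>{1..l}. card (?C j))"
    by (rule card_UN_disjoint[OF finite_atLeastAtMost _ disj]) simp
  also have "\<dots> = (\<Sum>j=1..l. \<nu> j)"
    by (intro sum.cong refl card)
  also have "\<dots> = card {1..n}"
    unfolding sum by simp
  finally have "card (\<Union>j\<in>{1..l}. ?C j) = card {1..n}" .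
  then have un: "(\<Union>j\<in>{1..l}. ?C j) = {1..n}"
    by (intro card_subset_eq[OF finite_atLeastAtMost]) blast+
  have "(\<Prod>i=1..n. z - p i t) = (\<Prod>i\<in>(\<Union>j\<in>{1..l}. ?C j). z - p i t)"
    by (simp only: un)
  also have "\<dots> = (\<Prod>j\<in>{1..l}. \<Prod>i\<in>?C j. z - p i t)"
    by (rule prod.UNION_disjoint[OF finite_atLeastAtMost _ disj]) simp
  also have "\<dots> = (\<Prod>j=1..l. (z - p j t) ^ \<nu> j)"
  proof (intro prod.cong refl)
    fix j assume j: "j \<in> {1..l}"
    have "(\<Prod>i\<in>?C j. z - p i t) = (\<Prod>i\<in>?C j. z - p j t)"
      by (rule prod.cong) simp_all
    also have "\<dots> = (z - p j t) ^ card (?C j)"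
      by (rule prod_constant)
    finally show "(\<Prod>i\<in>?C j. z - p i t) = (z - p j t) ^ \<nu> j"
      by (simp only: card[OF j])
  qed
  finally show ?thesis
    by (simp only: rat_g_def)
qed

definition res_term :: "(complex \<Rightarrow> complex) \<Rightarrow> (complex \<Rightarrow> complex) \<Rightarrow> complex \<Rightarrow> complex" where
  "res_term R g a = residue (\<lambda>z. z * R z * (deriv g z / g z)) a"

end

theory Submission
  imports Defs
begin

text \<open>
  On the disk \<open>f\<close> satisfies \<open>\<partial>\<^sub>t f = \<zeta> g P\<close>, by the Schwarz integral formula applied to \<open>\<partial>\<^sub>t f / (\<zeta> g)\<close>,
  so \<open>\<partial>\<^sub>t g / g = (\<zeta> P)' + \<zeta> P g' / g\<close> there. The zeros and poles lie outside the disk. Write \<open>g = N / D\<close>.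
  The polynomials \<open>(N\<^sub>s D\<^sub>t - N\<^sub>t D\<^sub>s) / (s - t)\<close> have bounded degree and converge on the disk as
  \<open>s \<rightarrow> t\<close>, hence they converge locally uniformly in the plane, and the identity continues to the
  plane with \<open>Q / (N\<^sub>t D\<^sub>t)\<close> in place of \<open>\<partial>\<^sub>t g / g\<close>, where \<open>Q\<close> is the limit. Integrating over a small
  circle around a zero or a pole, \<open>(\<zeta> P)'\<close> contributes nothing and the difference quotients of
  \<open>Q\<close> yield the velocity of the sum of the zeros (or of the poles, with the opposite sign).
  Individual members of a cluster of zeros can collide like square roots; a cubic polynomial flow
  with real coefficients shows this.
\<close>

subsection \<open>The Loewner-Kufarev equation\<close>

text \<open>This is the tube lemma: over a compact \<open>S\<close> one neighbourhood of
  \<open>t\<close> serves all \<open>z\<close> at once.\<close>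

lemma uniform_limit_compact_section:
  fixes U :: "'a::metric_space \<Rightarrow> 'b::topological_space \<Rightarrow> 'c::metric_space"
  assumes "continuous_on (I \<times> S) (\<lambda>(s, z). U s z)" "compact S" "t \<in> I"
  shows "uniform_limit S U (U t) (at t within I)"
proof (rule uniform_limitI)
  fix e :: real assume "e > 0"
  show "\<forall>\<^sub>F s in at t within I. \<forall>z\<in>S. dist (U s z) (U t z) < e"
  proof (rule continuous_on_prod_compactE[OF assms, of "e/2"])
    show "e/2 > 0" using \<open>e > 0\<close> by simp
    fix X assume X: "t \<in> X" "open X"
      "\<forall>s\<in>X \<inter> I. \<forall>z\<in>S. dist (case (s, z) of (s, z) \<Rightarrow> U s z) (case (t, z) of (s, z) \<Rightarrow> U s z) \<le> e/2"
    have "dist (U s z) (U t z) < e" if "s \<in> X" "s \<in> I" "z \<in> S" for s z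
    proof -
      have "dist (U s z) (U t z) \<le> e/2" using X(3) that by simp
      then show ?thesis using \<open>e > 0\<close> by linarith
    qed
    then show ?thesis
      unfolding eventually_at_topological using X(1,2) by blast
  qed
qed

text \<open>The mean value inequality bounds the linearization error by \<open>norm (s - t)\<close>
  times the oscillation of \<open>f'\<close> between \<open>t\<close> and \<open>s\<close>, and
  compactness of \<open>S\<close> makes this oscillation small for all \<open>z\<close> at once.
  Convexity of \<open>I\<close> keeps the segment from \<open>t\<close> to \<open>s\<close> inside
  \<open>I\<close>.\<close>

lemma uniform_limit_difference_quotient:
  fixes f :: "complex \<Rightarrow> real \<Rightarrow> complex"
  assumes "convex I" "t \<in> I" "compact S"
    and der: "\<And>z s. z \<in> S \<Longrightarrow> s \<in> I \<Longrightarrow> (f z has_vector_derivative f' z s) (at s within I)"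
    and cont: "continuous_on (S \<times> I) (\<lambda>(z, s). f' z s)"
  shows "uniform_limit S (\<lambda>s z. (f z s - f z t) / of_real (s - t)) (\<lambda>z. f' z t) (at t within I)"
proof (rule uniform_limitI)
  fix e :: real assume "e > 0"
  have "continuous_on (I \<times> S) (\<lambda>(s, z). f' z s)"
    using cont by (rule continuous_on_swap_args)
  then have "uniform_limit S (\<lambda>s z. f' z s) (\<lambda>z. f' z t) (at t within I)"
    using uniform_limit_compact_section[of I S "\<lambda>s z. f' z s"] assms by auto
  from uniform_limitD[OF this, of "e/2"] \<open>e > 0\<close> obtain d where "d > 0" and
    d': "\<And>s z. s \<in> I \<Longrightarrow> s \<noteq> t \<Longrightarrow> dist s t < d \<Longrightarrow> z \<in> S \<Longrightarrow> dist (f' z s) (f' z t) < e/2"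
    unfolding eventually_at by auto
  have d: "dist (f' z s) (f' z t) \<le> e/2" if "s \<in> I" "dist s t < d" "z \<in> S" for s z
    using d'[OF that(1) _ that(2,3)] \<open>e > 0\<close> by (cases "s = t") auto
  have "dist ((f z s - f z t) / of_real (s - t)) (f' z t) < e"
    if "s \<in> I" "s \<noteq> t" "dist s t < d" "z \<in> S" for s z
  proof -
    let ?J = "I \<inter> ball t d"
    have "convex ?J" using assms(1) by (simp add: convex_Int)
    have "norm (f z s - f z t - (s - t) *\<^sub>R f' z t) \<le> norm (s - t) * (e/2)"
    proof (rule differentiable_bound_linearization[where S = ?J and f' = "\<lambda>x h. h *\<^sub>R f' z x"])
      show "t + u *\<^sub>R (s - t) \<in> ?J" if "u \<in> {0..1}" for u
        using convexD_alt[OF \<open>convex ?J\<close>, of t s u] that \<open>s \<in> I\<close> \<open>dist s t < d\<close> \<open>d > 0\<close> \<open>t \<in> I\<close>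
        by (simp add: algebra_simps dist_commute)
      show "(f z has_derivative (\<lambda>h. h *\<^sub>R f' z x)) (at x within ?J)" if "x \<in> ?J" for x
        using der[OF \<open>z \<in> S\<close>, of x] that has_derivative_subset[of "f z" _ x I ?J]
        by (auto simp: has_vector_derivative_def)
      show "t \<in> ?J" using \<open>t \<in> I\<close> \<open>d > 0\<close> by auto
      show "onorm ((\<lambda>h. h *\<^sub>R f' z x) - (\<lambda>h. h *\<^sub>R f' z t)) \<le> e/2" if "x \<in> ?J" for x
      proof (rule onorm_le)
        fix h :: real
        have "norm (f' z x - f' z t) \<le> e/2"
          using d[of x z] that \<open>z \<in> S\<close> by (simp add: dist_norm dist_real_def abs_minus_commute)
        then have "norm (h *\<^sub>R (f' z x - f' z t)) \<le> (e/2) * norm h"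
          using mult_left_mono[of "norm (f' z x - f' z t)" "e/2" "norm h"] by (simp add: mult.commute)
        then show "norm (((\<lambda>h. h *\<^sub>R f' z x) - (\<lambda>h. h *\<^sub>R f' z t)) h) \<le> (e/2) * norm h"
          by (simp add: scaleR_diff_right)
      qed
    qed
    moreover have "(f z s - f z t) / of_real (s - t) - f' z t =
        (f z s - f z t - (s - t) *\<^sub>R f' z t) / of_real (s - t)"
      using \<open>s \<noteq> t\<close> by (simp add: diff_divide_distrib scaleR_conv_of_real flip: of_real_diff)
    ultimately have "norm ((f z s - f z t) / of_real (s - t) - f' z t) \<le> e/2"
      using \<open>s \<noteq> t\<close> by (simp add: norm_divide divide_le_eq mult.commute flip: of_real_diff)
    then show ?thesis using \<open>e > 0\<close> by (simp add: dist_norm)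
  qed
  then show "\<forall>\<^sub>F s in at t within I. \<forall>z\<in>S. dist ((f z s - f z t) / of_real (s - t)) (f' z t) < e"
    unfolding eventually_at using \<open>d > 0\<close> by (intro exI[of _ d]) blast
qed

text \<open>On the unit circle \<open>dz / z\<close> is the purely imaginary measure
  \<open>2 * pi * \<i> dx\<close>, so conjugating \<open>G\<close> conjugates the integral and
  reverses its sign.\<close>

lemma has_contour_integral_cnj_circlepath:
  assumes "((\<lambda>u. G u / u) has_contour_integral c) (circlepath 0 1)"
  shows "((\<lambda>u. cnj (G u) / u) has_contour_integral - cnj c) (circlepath 0 1)"
proof -
  let ?c = "circlepath 0 1"
  have v: "vector_derivative ?c (at x within {0..1}) = 2 * of_real pi * \<i> * ?c x" if "x \<in> {0..1}" for x
    using that vector_derivative_circlepath01[of x 0 1] by (simp add: circlepath)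
  have nz: "?c x \<noteq> 0" for x
    by (simp add: circlepath)
  have "((\<lambda>x. G (?c x) * (2 * of_real pi * \<i>)) has_integral c) {0..1}"
    using assms unfolding has_contour_integral_def
    by (rule has_integral_eq[rotated]) (simp add: v nz)
  then have "((\<lambda>x. - cnj (G (?c x) * (2 * of_real pi * \<i>))) has_integral - cnj c) {0..1}"
    by (intro has_integral_neg) (rule has_integral_cnj[unfolded o_def, THEN iffD2])
  then show ?thesis unfolding has_contour_integral_def
    by (rule has_integral_eq[rotated]) (simp add: v nz)
qed

text \<open>The real part is half of \<open>h + cnj h\<close>. For \<open>h\<close> the kernel
  splits as \<open>2 / (z - \<zeta>) - 1 / z\<close>, and Cauchy's formula applies twice. On the
  circle \<open>(z + \<zeta>) / (z - \<zeta>)\<close> is the conjugate of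
  \<open>(1 + cnj \<zeta> * z) / (1 - cnj \<zeta> * z)\<close>, which is holomorphic on the closed
  disk, so the part with \<open>cnj h\<close> is a conjugated Cauchy integral at 0.\<close>

lemma Schwarz_integral_formula:
  assumes cont: "continuous_on (cball 0 1) h" and hol: "h holomorphic_on ball 0 1" and "\<zeta> \<in> ball 0 1"
  shows "((\<lambda>z. of_real (Re (h z)) * ((z + \<zeta>) / (z - \<zeta>)) / z) has_contour_integral
            2 * of_real pi * \<i> * (h \<zeta> - \<i> * of_real (Im (h 0)))) (circlepath 0 1)"
proof -
  let ?c = "circlepath 0 1 :: real \<Rightarrow> complex"
  have img: "norm z = 1" if "z \<in> path_image ?c" for z
    using that by (simp add: path_image_circlepath)
  have ne: "z - \<zeta> \<noteq> 0" "z \<noteq> 0" if "norm z = 1" for z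
    using that \<open>\<zeta> \<in> ball 0 1\<close> by auto
  have 1: "((\<lambda>u. h u / (u - \<zeta>)) has_contour_integral 2 * of_real pi * \<i> * h \<zeta>) ?c"
    using Cauchy_integral_circlepath[of 0 1 h \<zeta>] assms by auto
  have 2: "((\<lambda>u. h u / u) has_contour_integral 2 * of_real pi * \<i> * h 0) ?c"
    using Cauchy_integral_circlepath[of 0 1 h 0] assms by auto
  have small: "1 - cnj \<zeta> * z \<noteq> 0" if "norm z \<le> 1" for z
  proof -
    have "norm (cnj \<zeta> * z) \<le> norm \<zeta> * 1"
      unfolding norm_mult complex_mod_cnj using that by (intro mult_left_mono) auto
    then show ?thesis using \<open>\<zeta> \<in> ball 0 1\<close> by auto
  qed
  have 3: "((\<lambda>u. (h u * ((1 + cnj \<zeta> * u) / (1 - cnj \<zeta> * u))) / (u - 0)) has_contour_integral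
      2 * of_real pi * \<i> * (h 0 * ((1 + cnj \<zeta> * 0) / (1 - cnj \<zeta> * 0)))) ?c"
  proof (rule Cauchy_integral_circlepath)
    show "continuous_on (cball 0 1) (\<lambda>u. h u * ((1 + cnj \<zeta> * u) / (1 - cnj \<zeta> * u)))"
      using small by (intro continuous_intros cont) auto
    show "(\<lambda>u. h u * ((1 + cnj \<zeta> * u) / (1 - cnj \<zeta> * u))) holomorphic_on ball 0 1"
      using small by (intro holomorphic_intros hol) auto
  qed auto
  have 3: "((\<lambda>u. cnj (h u * ((1 + cnj \<zeta> * u) / (1 - cnj \<zeta> * u))) / u) has_contour_integral
      - cnj (2 * of_real pi * \<i> * h 0)) ?c"
    using has_contour_integral_cnj_circlepath[OF 3[unfolded diff_0_right]] by simp
  have "((\<lambda>u. ((2 * (h u / (u - \<zeta>)) - h u / u) +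
            cnj (h u * ((1 + cnj \<zeta> * u) / (1 - cnj \<zeta> * u))) / u) / 2) has_contour_integral
        ((2 * (2 * of_real pi * \<i> * h \<zeta>) - 2 * of_real pi * \<i> * h 0) + - cnj (2 * of_real pi * \<i> * h 0)) / 2) ?c"
    by (intro has_contour_integral_div has_contour_integral_add has_contour_integral_diff
        has_contour_integral_lmul 1 2 3)
  moreover have "((2 * (h u / (u - \<zeta>)) - h u / u) + cnj (h u * ((1 + cnj \<zeta> * u) / (1 - cnj \<zeta> * u))) / u) / 2
      = of_real (Re (h u)) * ((u + \<zeta>) / (u - \<zeta>)) / u" if "u \<in> path_image ?c" for u
  proof -
    have u: "norm u = 1" using img[OF that] .
    have c: "u * cnj u = 1" using u by (simp add: complex_norm_square[symmetric])
    have "cnj ((1 + cnj \<zeta> * u) / (1 - cnj \<zeta> * u)) = (u * (1 + \<zeta> * cnj u)) / (u * (1 - \<zeta> * cnj u))"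
      using ne[OF u] by simp
    also have "\<dots> = (u + \<zeta> * (u * cnj u)) / (u - \<zeta> * (u * cnj u))"
      by (simp add: algebra_simps)
    finally have a: "cnj ((1 + cnj \<zeta> * u) / (1 - cnj \<zeta> * u)) = (u + \<zeta>) / (u - \<zeta>)"
      using c by simp
    have b: "2 * (h u / (u - \<zeta>)) - h u / u = h u * ((u + \<zeta>) / (u - \<zeta>)) / u"
      using ne[OF u] by (simp add: divide_simps) (simp add: algebra_simps)
    have "2 * complex_of_real (Re (h u)) = h u + cnj (h u)"
      by (simp add: complex_add_cnj)
    then have r: "complex_of_real (Re (h u)) = (h u + cnj (h u)) / 2"
      by (simp add: nonzero_eq_divide_eq mult.commute)
    show ?thesis unfolding complex_cnj_mult a b r
      by (simp add: algebra_simps add_divide_distrib)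
  qed
  moreover have "((2 * (2 * of_real pi * \<i> * h \<zeta>) - 2 * of_real pi * \<i> * h 0) + - cnj (2 * of_real pi * \<i> * h 0)) / 2
      = 2 * of_real pi * \<i> * (h \<zeta> - \<i> * of_real (Im (h 0)))"
    by (simp add: complex_eq_iff field_simps)
  ultimately show ?thesis
    by (simp only: has_contour_integral_eq)
qed

section \<open>Regularity of the time derivative of a solution\<close>

lemma has_vector_derivative_iff_quotient:
  fixes F :: "real \<Rightarrow> complex"
  shows "(F has_vector_derivative D) (at t within I) \<longleftrightarrow>
    ((\<lambda>s. (F s - F t) / of_real (s - t)) \<longlongrightarrow> D) (at t within I)"
proof -
  have "norm (F s - F t - (s - t) *\<^sub>R D) / norm (s - t) = norm ((F s - F t) / of_real (s - t) - D)"
    if "s \<noteq> t" for s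
  proof -
    have "(F s - F t) / of_real (s - t) - D = (F s - F t - (s - t) *\<^sub>R D) / of_real (s - t)"
      using that by (simp add: diff_divide_distrib scaleR_conv_of_real flip: of_real_diff)
    then show ?thesis by (simp add: norm_divide flip: of_real_diff)
  qed
  then have "\<forall>\<^sub>F s in at t within I.
      norm (F s - F t - (s - t) *\<^sub>R D) / norm (s - t) = norm ((F s - F t) / of_real (s - t) - D)"
    by (auto simp: eventually_at_filter)
  then show ?thesis
    unfolding has_vector_derivative_def has_derivative_iff_norm
    by (subst tendsto_cong) (auto simp: bounded_linear_scaleR_left tendsto_norm_zero_iff LIM_zero_iff)
qed

text \<open>A connected set with more than one point has no isolated points. This makes limits in
  time unique, also at end points of \<open>I\<close>.\<close>

lemma at_within_interval_neq_bot:
  fixes I :: "real set"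
  assumes "is_interval I" "interior I \<noteq> {}" "t \<in> I"
  shows "at t within I \<noteq> bot"
proof -
  have "connected I" using assms(1) by (simp add: is_interval_connected)
  moreover have "I \<noteq> {x}" for x using assms(2) by auto
  ultimately have "t islimpt I" using assms(3) by (blast intro: connected_imp_perfect)
  then show ?thesis by (simp add: trivial_limit_within)
qed

lemma tderiv_has_vector_derivative:
  assumes "smooth_in_time I f" "z \<in> cball 0 1" "s \<in> I"
  shows "((\<lambda>s. f z s) has_vector_derivative tderiv I f z s) (at s within I)"
  using assms unfolding smooth_in_time_def tderiv_def by (auto simp: vector_derivative_works[symmetric])

lemma uniform_limit_time_quotient:
  assumes "locally_univalent_solution I q f" "t \<in> I"
  shows "uniform_limit (cball 0 1) (\<lambda>s z. (f z s - f z t) / of_real (s - t)) (\<lambda>z. tderiv I f z t) (at t within I)"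
  using assms unfolding locally_univalent_solution_def
  by (intro uniform_limit_difference_quotient[where f = f and f' = "tderiv I f"] tderiv_has_vector_derivative)
    (auto simp: is_interval_convex smooth_in_time_def)

lemma holomorphic_on_solution:
  assumes "locally_univalent_solution I q f" "t \<in> I"
  shows "(\<lambda>z. f z t) holomorphic_on cball 0 1"
  using assms unfolding locally_univalent_solution_def by (auto intro: analytic_imp_holomorphic)

text \<open>Weierstrass: the difference quotients in time are holomorphic in \<open>z\<close> and
  converge uniformly on the closed disk. Continuity up to the boundary is what the Schwarz formula
  asks for.\<close>

lemma tderiv_holomorphic:
  assumes sol: "locally_univalent_solution I q f" and "t \<in> I"
  shows "continuous_on (cball 0 1) (\<lambda>z. tderiv I f z t)" (is ?C)
    and "(\<lambda>z. tderiv I f z t) holomorphic_on ball 0 1" (is ?H)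
proof -
  \<comment> \<open>For \<open>s = t\<close> division by zero makes the quotient the constant
    0.\<close>
  have q: "(\<lambda>z. (f z s - f z t) / of_real (s - t)) holomorphic_on cball 0 1" if "s \<in> I" for s
    by (cases "s = t") (auto intro!: holomorphic_intros holomorphic_on_solution[OF sol] that \<open>t \<in> I\<close>)
  have nb: "at t within I \<noteq> bot"
    using at_within_interval_neq_bot sol \<open>t \<in> I\<close> by (auto simp: locally_univalent_solution_def)
  have "\<forall>\<^sub>F s in at t within I. s \<in> I"
    by (simp add: eventually_at_filter)
  then have "\<forall>\<^sub>F s in at t within I. continuous_on (cball 0 1) (\<lambda>z. (f z s - f z t) / of_real (s - t)) \<and>
      (\<lambda>z. (f z s - f z t) / of_real (s - t)) holomorphic_on ball 0 1"
  proof eventually_elim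
    case (elim s)
    show ?case
      using holomorphic_on_imp_continuous_on[OF q[OF elim]] holomorphic_on_subset[OF q[OF elim] ball_subset_cball]
      by blast
  qed
  from holomorphic_uniform_limit[OF this uniform_limit_time_quotient[OF sol \<open>t \<in> I\<close>] nb]
  show ?C ?H by auto
qed

text \<open>Uniform convergence of holomorphic functions passes to their complex derivatives, so the
  derivatives in time and in space commute. In particular \<open>f'\<close> turns out to be
  differentiable in time inside the disk.\<close>

lemma tderiv_deriv:
  assumes sol: "locally_univalent_solution I q f" and "t \<in> I" and z: "z \<in> ball 0 1"
  shows "((\<lambda>s. deriv (\<lambda>w. f w s) z) has_vector_derivative deriv (\<lambda>w. tderiv I f w t) z) (at t within I)"
proof -
  have hol: "(\<lambda>w. f w s) holomorphic_on ball 0 1" if "s \<in> I" for s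
    using holomorphic_on_solution[OF sol that] by (rule holomorphic_on_subset) auto
  have nb: "at t within I \<noteq> bot"
    using at_within_interval_neq_bot sol \<open>t \<in> I\<close> by (auto simp: locally_univalent_solution_def)
  have inI: "\<forall>\<^sub>F s in at t within I. s \<in> I"
    by (simp add: eventually_at_filter)
  have "((\<lambda>s. (deriv ^^ 1) (\<lambda>w. (f w s - f w t) / of_real (s - t)) z) \<longlongrightarrow>
      (deriv ^^ 1) (\<lambda>w. tderiv I f w t) z) (at t within I)"
  proof (rule higher_deriv_complex_uniform_limit[OF _ _ nb open_ball z])
    show "uniform_limit (ball 0 1) (\<lambda>s z. (f z s - f z t) / of_real (s - t)) (\<lambda>z. tderiv I f z t) (at t within I)"
      using uniform_limit_time_quotient[OF sol \<open>t \<in> I\<close>] by (rule uniform_limit_on_subset) auto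
    show "\<forall>\<^sub>F s in at t within I. (\<lambda>z. (f z s - f z t) / of_real (s - t)) holomorphic_on ball 0 1"
      using eventually_conj[OF inI eventually_neq_at_within[of t t I]]
      by eventually_elim (auto intro!: holomorphic_intros hol \<open>t \<in> I\<close>)
  qed
  moreover have "\<forall>\<^sub>F s in at t within I. (deriv ^^ 1) (\<lambda>w. (f w s - f w t) / of_real (s - t)) z =
      (deriv (\<lambda>w. f w s) z - deriv (\<lambda>w. f w t) z) / of_real (s - t)"
    using inI
  proof eventually_elim
    case (elim s)
    have d: "(\<lambda>w. f w s) field_differentiable at z" if "s \<in> I" for s
      using hol[OF that] z holomorphic_on_imp_differentiable_at by blast
    show ?case using d[OF elim] d[OF \<open>t \<in> I\<close>]
      by (simp add: deriv_cdivide_right field_differentiable_diff)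
  qed
  ultimately have "((\<lambda>s. (deriv (\<lambda>w. f w s) z - deriv (\<lambda>w. f w t) z) / of_real (s - t)) \<longlongrightarrow>
      deriv (\<lambda>w. tderiv I f w t) z) (at t within I)"
    using tendsto_cong by fastforce
  then show ?thesis
    by (simp add: has_vector_derivative_iff_quotient)
qed

text \<open>The function \<open>h\<close>, which is the time derivative divided by
  \<open>z * f'\<close>, is holomorphic on the disk, and by the Polubarinova-Galin equation its real
  part on the circle is the density in \<open>LK_P\<close>. The Schwarz formula then recovers
  \<open>h\<close> up to an imaginary constant, which the normalization of \<open>f\<close> at 0
  removes.\<close>

theorem Loewner_Kufarev:
  assumes sol: "locally_univalent_solution I q f" and "t \<in> I" and \<zeta>: "\<zeta> \<in> ball 0 1"
  shows "tderiv I f \<zeta> t = \<zeta> * deriv (\<lambda>w. f w t) \<zeta> * LK_P q f \<zeta> t"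
proof -
  define F where "F = (\<lambda>z. deriv (\<lambda>w. f w t) z)"
  define d where "d = (\<lambda>z. tderiv I f z t)"
  \<comment> \<open>This is \<open>d z / z\<close> with the removable singularity at 0 filled in;
    that \<open>d 0 = 0\<close> is shown below.\<close>
  define k where "k = (\<lambda>z. if z = 0 then deriv d 0 else (d z - d 0) / (z - 0))"
  define h where "h = (\<lambda>z. k z / F z)"
  have an: "(\<lambda>w. f w t) analytic_on cball 0 1"
    and F0: "\<And>z. z \<in> cball 0 1 \<Longrightarrow> F z \<noteq> 0"
    and PG: "\<And>z. z \<in> sphere 0 1 \<Longrightarrow> Re (d z * cnj (z * F z)) = q t"
    and f0: "\<And>s. s \<in> I \<Longrightarrow> f 0 s = 0" and Im0: "\<And>s. s \<in> I \<Longrightarrow> Im (deriv (\<lambda>w. f w s) 0) = 0"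
    using sol \<open>t \<in> I\<close> by (auto simp: locally_univalent_solution_def F_def d_def)
  have nb: "at t within I \<noteq> bot"
    using at_within_interval_neq_bot sol \<open>t \<in> I\<close> by (auto simp: locally_univalent_solution_def)
  have F: "F holomorphic_on cball 0 1"
    unfolding F_def using analytic_deriv[OF an] by (rule analytic_imp_holomorphic)
  have dC: "continuous_on (cball 0 1) d" and dH: "d holomorphic_on ball 0 1"
    using tderiv_holomorphic[OF sol \<open>t \<in> I\<close>] by (auto simp: d_def)
  have smooth: "smooth_in_time I f"
    using sol by (auto simp: locally_univalent_solution_def)
  have "((\<lambda>s. 0) has_vector_derivative d 0) (at t within I)"
    unfolding d_def
    by (rule has_vector_derivative_transform[OF \<open>t \<in> I\<close> _ tderiv_has_vector_derivative[OF smooth _ \<open>t \<in> I\<close>]])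
      (auto simp: f0)
  then have d0: "d 0 = 0"
    using vector_derivative_unique_within[OF nb _ has_vector_derivative_const] by blast
  \<comment> \<open>\<open>f'\<close> is real at 0 for all times, hence so is its time derivative
    there; this is what makes \<open>Im (h 0)\<close> vanish.\<close>
  have "((\<lambda>s. Im (deriv (\<lambda>w. f w s) 0)) has_vector_derivative Im (deriv d 0)) (at t within I)"
    using tderiv_deriv[OF sol \<open>t \<in> I\<close>, of 0] unfolding d_def
    by (intro bounded_linear.has_vector_derivative[OF bounded_linear_Im]) auto
  then have "((\<lambda>s. 0) has_vector_derivative Im (deriv d 0)) (at t within I)"
    by (rule has_vector_derivative_transform[OF \<open>t \<in> I\<close>, rotated]) (auto simp: Im0)
  then have Im_d: "Im (deriv d 0) = 0"
    using vector_derivative_unique_within[OF nb _ has_vector_derivative_const] by blast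
  have k: "k holomorphic_on ball 0 1"
    unfolding k_def by (intro pole_lemma dH) auto
  have kC: "continuous_on (cball 0 1) k"
  proof (rule continuous_on_subset)
    \<comment> \<open>Continuity is glued from two relatively open pieces: the quotient formula away
      from 0, which reaches the boundary, and holomorphy inside the disk.\<close>
    show "continuous_on ((cball 0 1 - {0}) \<union> ball 0 1) k"
    proof (rule continuous_on_Un_local_open)
      show "continuous_on (ball 0 1) k" using k by (rule holomorphic_on_imp_continuous_on)
      have "continuous_on (cball 0 1 - {0}) (\<lambda>z. (d z - d 0) / (z - 0))"
        by (intro continuous_intros continuous_on_subset[OF dC]) auto
      then show "continuous_on (cball 0 1 - {0}) k"
        by (rule continuous_on_eq) (auto simp: k_def)
      show "openin (top_of_set (cball 0 1 - {0} \<union> ball 0 1)) (cball 0 1 - {0 :: complex})"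
        by (rule openin_subset_trans[where U = "cball (0 :: complex) 1"]) (auto intro: openin_delete)
      show "openin (top_of_set (cball 0 1 - {0} \<union> ball 0 1)) (ball (0 :: complex) 1)"
        by (rule open_subset) auto
    qed
  qed auto
  have h0: "Im (h 0) = 0"
    using Im_d Im0[OF \<open>t \<in> I\<close>] by (simp add: h_def k_def F_def Im_divide)
  have "((\<lambda>z. of_real (Re (h z)) * ((z + \<zeta>) / (z - \<zeta>)) / z) has_contour_integral
            2 * of_real pi * \<i> * (h \<zeta> - \<i> * of_real (Im (h 0)))) (circlepath 0 1)"
  proof (rule Schwarz_integral_formula[OF _ _ \<zeta>])
    show "continuous_on (cball 0 1) h"
      unfolding h_def using F0 by (intro continuous_intros kC holomorphic_on_imp_continuous_on[OF F]) auto
    show "h holomorphic_on ball 0 1"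
      unfolding h_def using F0 by (intro holomorphic_intros k holomorphic_on_subset[OF F]) auto
  qed
  moreover have "Re (h z) = q t / (cmod (F z))\<^sup>2" if "z \<in> sphere 0 1" for z
  proof -
    have z: "cmod z = 1" "z \<noteq> 0" using that by auto
    have "h z = d z / (z * F z)"
      using z by (simp add: h_def k_def d0)
    \<comment> \<open>Expanding by the conjugate of the denominator brings out the left-hand side of
      the Polubarinova-Galin equation.\<close>
    also have "\<dots> = d z * cnj (z * F z) / of_real ((cmod (z * F z))\<^sup>2)"
      by (subst complex_div_cnj) simp
    finally show ?thesis
      using PG[OF that] z by (simp add: norm_mult del: of_real_power)
  qed
  ultimately have "((\<lambda>z. of_real (q t / (cmod (F z))\<^sup>2) * ((z + \<zeta>) / (z - \<zeta>)) / z) has_contour_integral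
            2 * of_real pi * \<i> * h \<zeta>) (circlepath 0 1)"
    using h0 by (auto elim!: has_contour_integral_eq)
  then have "LK_P q f \<zeta> t = h \<zeta>"
    unfolding LK_P_def F_def[symmetric] by (simp add: contour_integral_unique)
  moreover have "d \<zeta> = \<zeta> * k \<zeta>"
    by (simp add: k_def d0)
  moreover have "F \<zeta> \<noteq> 0"
    using F0 \<zeta> by auto
  ultimately show ?thesis
    by (simp add: h_def d_def F_def)
qed

subsection \<open>Roots of time-dependent polynomials\<close>

text \<open>Lagrange interpolation: a polynomial of degree below \<open>card A\<close> is the
  combination of fixed basis polynomials \<open>L x\<close> with its values on \<open>A\<close> as
  coefficients. Convergence of these finitely many values is therefore uniform convergence on every
  compact set.\<close>

lemma uniform_limit_poly_interpolation:
  fixes P :: "'b \<Rightarrow> complex poly"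
  assumes "finite A" and deg: "\<And>s. degree (P s) < card A"
    and lim: "\<And>x. x \<in> A \<Longrightarrow> ((\<lambda>s. poly (P s) x) \<longlongrightarrow> c x) F"
  obtains Q where "\<And>S. compact S \<Longrightarrow> uniform_limit S (\<lambda>s. poly (P s)) (poly Q) F"
proof
  define L where "L = (\<lambda>x. \<Prod>y\<in>A - {x}. smult (1 / (x - y)) [:- y, 1:])"
  define Q where "Q = (\<Sum>x\<in>A. smult (c x) (L x))"
  have degL: "degree (L x) < card A" if "x \<in> A" for x
  proof -
    have "degree (L x) \<le> (\<Sum>y\<in>A - {x}. degree (smult (1 / (x - y)) [:- y, 1:]))"
      unfolding L_def by (rule order.trans[OF degree_prod_sum_le]) (use \<open>finite A\<close> in auto)
    also have "\<dots> \<le> (\<Sum>y\<in>A - {x}. 1)"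
      by (intro sum_mono order.trans[OF degree_smult_le]) simp
    also have "\<dots> < card A"
      using card_Diff1_less[OF \<open>finite A\<close> that] by simp
    finally show ?thesis .
  qed
  have L_eq: "poly (L x) y = (if x = y then 1 else 0)" if "x \<in> A" "y \<in> A" for x y
  proof (cases "x = y")
    case True
    then show ?thesis
      by (auto simp: L_def poly_prod simp flip: diff_divide_distrib intro!: prod.neutral split: if_splits)
  next
    case False
    then show ?thesis using that \<open>finite A\<close> by (auto simp: L_def poly_prod)
  qed
  have interp: "P s = (\<Sum>x\<in>A. smult (poly (P s) x) (L x))" for s
  proof (rule poly_eqI_degree[where A = A])
    show "poly (P s) y = poly (\<Sum>x\<in>A. smult (poly (P s) x) (L x)) y" if "y \<in> A" for y
      using that \<open>finite A\<close> by (simp add: poly_sum L_eq if_distrib sum.delta cong: if_cong sum.cong)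
    have "card A > 0" using deg[of s] by simp
    then show "degree (\<Sum>x\<in>A. smult (poly (P s) x) (L x)) < card A"
      by (intro degree_sum_less) (auto intro: le_less_trans[OF degree_smult_le] degL)
  qed (rule deg)
  fix S :: "complex set" assume "compact S"
  define B where "B = (\<lambda>x. SUP z\<in>S. norm (poly (L x) z))"
  have B: "norm (poly (L x) z) \<le> B x" if "z \<in> S" for x z
    unfolding B_def
  proof (rule cSUP_upper[OF that])
    have "compact ((\<lambda>z. norm (poly (L x) z)) ` S)"
      by (intro compact_continuous_image continuous_intros \<open>compact S\<close>)
    then show "bdd_above ((\<lambda>z. norm (poly (L x) z)) ` S)"
      by (intro bounded_imp_bdd_above compact_imp_bounded)
  qed
  have "((\<lambda>s. \<Sum>x\<in>A. norm (poly (P s) x - c x) * B x) \<longlongrightarrow> (\<Sum>x\<in>A. norm (c x - c x) * B x)) F"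
    by (intro tendsto_intros lim)
  then have lim0: "((\<lambda>s. \<Sum>x\<in>A. norm (poly (P s) x - c x) * B x) \<longlongrightarrow> 0) F"
    by simp
  show "uniform_limit S (\<lambda>s. poly (P s)) (poly Q) F"
  proof (rule uniform_limitI)
    fix e :: real assume "e > 0"
    from order_tendstoD(2)[OF lim0 this]
    show "\<forall>\<^sub>F s in F. \<forall>z\<in>S. dist (poly (P s) z) (poly Q z) < e"
    proof eventually_elim
      case (elim s)
      have "dist (poly (P s) z) (poly Q z) < e" if "z \<in> S" for z
      proof -
        have "poly (P s) z - poly Q z = (\<Sum>x\<in>A. (poly (P s) x - c x) * poly (L x) z)"
          by (subst interp) (simp add: Q_def poly_sum sum_subtractf left_diff_distrib)
        then have "dist (poly (P s) z) (poly Q z) \<le> (\<Sum>x\<in>A. norm ((poly (P s) x - c x) * poly (L x) z))"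
          by (simp add: dist_norm norm_sum)
        also have "\<dots> \<le> (\<Sum>x\<in>A. norm (poly (P s) x - c x) * B x)"
          unfolding norm_mult by (intro sum_mono mult_left_mono B that) auto
        finally show ?thesis using elim by simp
      qed
      then show ?case by blast
    qed
  qed
qed

section \<open>Contour integrals around a cluster of roots\<close>

lemma has_contour_integral_inverse_power_circlepath:
  assumes "r > 0"
  shows "((\<lambda>z. 1 / (z - a) ^ Suc n) has_contour_integral (if n = 0 then 2 * of_real pi * \<i> else 0)) (circlepath a r)"
proof -
  have "((\<lambda>z. 1 / (z - a) ^ Suc n) has_contour_integral (2 * of_real pi * \<i> / fact n) * (deriv ^^ n) (\<lambda>_. 1) a) (circlepath a r)"
    using Cauchy_has_contour_integral_higher_derivative_circlepath[of a r "\<lambda>_. 1" a n] assms by simp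
  then show ?thesis by (cases n) (auto simp: higher_deriv_const)
qed

text \<open>Each factor is \<open>1 + (a - w i) / (z - a)\<close>. In the expanded product only the
  coefficient of \<open>1 / (z - a)\<close> survives integration, and it is the sum of the
  \<open>a - w i\<close>.\<close>

lemma has_contour_integral_prod_quotient:
  fixes w :: "'i \<Rightarrow> complex"
  assumes "finite K" "r > 0"
  shows "((\<lambda>z. \<Prod>i\<in>K. (z - w i) / (z - a)) has_contour_integral 2 * of_real pi * \<i> * (\<Sum>i\<in>K. a - w i)) (circlepath a r)"
proof -
  let ?c = "circlepath a r"
  have img: "z \<noteq> a" if "z \<in> path_image ?c" for z
    using that \<open>r > 0\<close> by auto
  \<comment> \<open>A new factor multiplies the old product by one more power of
    \<open>1 / (z - a)\<close>, so the induction has to carry the integrals with all such extra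
    powers.\<close>
  have "((\<lambda>z. \<Prod>i\<in>K. (z - w i) / (z - a)) has_contour_integral 2 * of_real pi * \<i> * (\<Sum>i\<in>K. a - w i)) ?c \<and>
    (\<forall>n. ((\<lambda>z. (\<Prod>i\<in>K. (z - w i) / (z - a)) * (1 / (z - a) ^ Suc n)) has_contour_integral
       (if n = 0 then 2 * of_real pi * \<i> else 0)) ?c)"
    using \<open>finite K\<close>
  proof induction
    case empty
    have "((\<lambda>z. 1) has_contour_integral 0) ?c"
      by (rule Cauchy_theorem_convex_simple[where S = UNIV]) auto
    then show ?case
      using has_contour_integral_inverse_power_circlepath[OF \<open>r > 0\<close>, of a] by simp
  next
    case (insert j K)
    let ?P = "\<lambda>z. \<Prod>i\<in>K. (z - w i) / (z - a)"
    have step: "(\<Prod>i\<in>insert j K. (z - w i) / (z - a)) = ?P z + (a - w j) * (?P z * (1 / (z - a) ^ Suc 0))"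
      if "z \<in> path_image ?c" for z
    proof -
      have "(z - w j) / (z - a) = 1 + (a - w j) / (z - a)"
        using img[OF that] by (simp add: field_simps)
      then show ?thesis using insert.hyps by (simp add: algebra_simps)
    qed
    from insert.IH have IH: "(?P has_contour_integral 2 * of_real pi * \<i> * (\<Sum>i\<in>K. a - w i)) ?c"
      and IH': "\<And>n. ((\<lambda>z. ?P z * (1 / (z - a) ^ Suc n)) has_contour_integral
        (if n = 0 then 2 * of_real pi * \<i> else 0)) ?c" by blast+
    have "((\<lambda>z. \<Prod>i\<in>insert j K. (z - w i) / (z - a)) has_contour_integral
        2 * of_real pi * \<i> * (\<Sum>i\<in>K. a - w i) + (a - w j) * (if (0::nat) = 0 then 2 * of_real pi * \<i> else 0)) ?c"
      by (rule has_contour_integral_eq[OF has_contour_integral_add[OF IH has_contour_integral_lmul[OF IH'[of 0]]]])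
        (simp only: step)
    moreover have "((\<lambda>z. (\<Prod>i\<in>insert j K. (z - w i) / (z - a)) * (1 / (z - a) ^ Suc n)) has_contour_integral
        (if n = 0 then 2 * of_real pi * \<i> else 0) + (a - w j) * (if Suc n = 0 then 2 * of_real pi * \<i> else 0)) ?c" for n
    proof (rule has_contour_integral_eq[OF has_contour_integral_add[OF IH'[of n] has_contour_integral_lmul[OF IH'[of "Suc n"]]]])
      fix z assume z: "z \<in> path_image ?c"
      show "?P z * (1 / (z - a) ^ Suc n) + (a - w j) * (?P z * (1 / (z - a) ^ Suc (Suc n))) =
        (\<Prod>i\<in>insert j K. (z - w i) / (z - a)) * (1 / (z - a) ^ Suc n)"
        unfolding step[OF z] power_one_over[symmetric]
        by (simp only: power_Suc power_0 mult_1_right mult_1_left distrib_right distrib_left mult_ac)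
    qed
    ultimately show ?case
      using insert.hyps by (simp add: algebra_simps)
  qed
  then show ?thesis by blast
qed

text \<open>Dividing \<open>E s\<close> by \<open>(z - a) ^ card K * U s z\<close> leaves, up to the factor \<open>s - t\<close>, the quotient
  of the two monic factors, whose residue is the displacement of the sum of the roots, minus
  \<open>V s / U s\<close>, which is holomorphic and so contributes nothing to the contour integral.\<close>

lemma has_vector_derivative_sum_roots:
  fixes w :: "'i \<Rightarrow> real \<Rightarrow> complex" and E U V :: "real \<Rightarrow> complex \<Rightarrow> complex"
  assumes "finite K" "r > 0" "t \<in> I" and nb: "at t within I \<noteq> bot"
    and w0: "\<And>i. i \<in> K \<Longrightarrow> w i t = a"
    and E: "\<And>s z. s \<in> I \<Longrightarrow> s \<noteq> t \<Longrightarrow> of_real (s - t) * E s z =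
      (\<Prod>i\<in>K. z - w i s) * U s z - (z - a) ^ card K * V s z"
    and E_lim: "uniform_limit (sphere a r) E Q (at t within I)"
    and Q: "continuous_on (sphere a r) Q"
    and U_cont: "continuous_on (I \<times> cball a r) (\<lambda>(s, z). U s z)"
    and U_nz: "\<And>z. z \<in> cball a r \<Longrightarrow> U t z \<noteq> 0"
    and hol: "\<And>s. s \<in> I \<Longrightarrow> U s holomorphic_on cball a r" "\<And>s. s \<in> I \<Longrightarrow> V s holomorphic_on cball a r"
  shows "((\<lambda>s. \<Sum>i\<in>K. w i s) has_vector_derivative
    - (contour_integral (circlepath a r) (\<lambda>z. Q z / ((z - a) ^ card K * U t z)) / (2 * of_real pi * \<i>)))
    (at t within I)"
proof -
  let ?c = "circlepath a r" and ?M = "\<lambda>s z. (z - a) ^ card K * U s z"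
  have U_lim: "uniform_limit (cball a r) U (U t) (at t within I)"
    by (rule uniform_limit_compact_section[OF U_cont _ \<open>t \<in> I\<close>]) simp
  \<comment> \<open>As soon as \<open>U s\<close> is within \<open>c\<close> of \<open>U t\<close>,
    it has no zeros on the disk; the same \<open>c\<close> bounds the limiting denominator away from
    0 on the circle.\<close>
  obtain c where "c > 0" and c: "\<And>z. z \<in> cball a r \<Longrightarrow> c \<le> norm (U t z)"
  proof -
    have "continuous_on (cball a r) (\<lambda>z. norm (U t z))"
      using hol(1)[OF \<open>t \<in> I\<close>] by (intro continuous_intros holomorphic_on_imp_continuous_on)
    then obtain z0 where "z0 \<in> cball a r" "\<And>z. z \<in> cball a r \<Longrightarrow> norm (U t z0) \<le> norm (U t z)"
      using continuous_attains_inf[of "cball a r" "\<lambda>z. norm (U t z)"] \<open>r > 0\<close> by auto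
    then show ?thesis using that[of "norm (U t z0)"] U_nz by auto
  qed
  have inI: "\<forall>\<^sub>F s in at t within I. s \<in> I" "\<forall>\<^sub>F s in at t within I. s \<noteq> t"
    by (auto simp: eventually_at_filter)
  have integral: "\<forall>\<^sub>F s in at t within I. ((\<lambda>z. E s z / ?M s z) has_contour_integral
      1 / of_real (s - t) * (2 * of_real pi * \<i> * (\<Sum>i\<in>K. a - w i s) - 0)) ?c"
    using uniform_limitD[OF U_lim \<open>c > 0\<close>] inI
  proof eventually_elim
    case (elim s)
    have nz: "U s z \<noteq> 0" if "z \<in> cball a r" for z
      using elim(1) c[OF that] that by (force simp: dist_norm)
    have VU: "((\<lambda>z. V s z / U s z) has_contour_integral 0) ?c"
    proof (rule Cauchy_theorem_convex_simple[where S = "cball a r"])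
      show "(\<lambda>z. V s z / U s z) holomorphic_on cball a r"
        using elim hol nz by (intro holomorphic_intros) auto
    qed (use \<open>r > 0\<close> in auto)
    show ?case
    proof (rule has_contour_integral_eq[OF has_contour_integral_lmul[OF has_contour_integral_diff[OF
              has_contour_integral_prod_quotient[OF \<open>finite K\<close> \<open>r > 0\<close>] VU]]])
      fix z assume "z \<in> path_image ?c"
      then have z: "z \<in> sphere a r" using \<open>r > 0\<close> by simp
      then have "z - a \<noteq> 0" "U s z \<noteq> 0" using nz[of z] \<open>r > 0\<close> by auto
      moreover have "of_real (s - t) * E s z = (\<Prod>i\<in>K. z - w i s) * U s z - (z - a) ^ card K * V s z"
        using E elim by blast
      moreover have "complex_of_real (s - t) \<noteq> 0" using elim by simp
      ultimately show "1 / of_real (s - t) * ((\<Prod>i\<in>K. (z - w i s) / (z - a)) - V s z / U s z) = E s z / ?M s z"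
        by (simp add: prod_dividef divide_simps mult.commute mult.left_commute)
    qed
  qed
  have "((\<lambda>s. contour_integral ?c (\<lambda>z. E s z / ?M s z)) \<longlongrightarrow> contour_integral ?c (\<lambda>z. Q z / ?M t z)) (at t within I)"
  proof (rule contour_integral_uniform_limit_circlepath(2)[OF _ _ nb \<open>r > 0\<close>])
    show "\<forall>\<^sub>F s in at t within I. (\<lambda>z. E s z / ?M s z) contour_integrable_on ?c"
      using integral by eventually_elim (auto simp: contour_integrable_on_def)
    show "uniform_limit (sphere a r) (\<lambda>s z. E s z / ?M s z) (\<lambda>z. Q z / ?M t z) (at t within I)"
    proof (rule uniform_lim_divide[OF E_lim])
      show "uniform_limit (sphere a r) ?M (?M t) (at t within I)"
      proof (rule uniform_limit_compact_section[OF _ _ \<open>t \<in> I\<close>])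
        have "continuous_on (I \<times> sphere a r) (\<lambda>x. U (fst x) (snd x))"
          using U_cont by (intro continuous_on_subset[OF U_cont[unfolded case_prod_unfold]]) auto
        then show "continuous_on (I \<times> sphere a r) (\<lambda>(s, z). ?M s z)"
          unfolding case_prod_unfold by (intro continuous_intros)
      qed simp
      show "bounded (Q ` sphere a r)"
        by (intro compact_imp_bounded compact_continuous_image Q) auto
      show "r ^ card K * c \<le> norm (?M t z)" if "z \<in> sphere a r" for z
        using that c[of z] \<open>r > 0\<close> by (auto simp: norm_mult norm_power dist_norm norm_minus_commute)
      show "r ^ card K * c > 0" using \<open>r > 0\<close> \<open>c > 0\<close> by simp
    qed
  qed
  then have "((\<lambda>s. - (contour_integral ?c (\<lambda>z. E s z / ?M s z) / (2 * of_real pi * \<i>))) \<longlongrightarrow>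
     - (contour_integral ?c (\<lambda>z. Q z / ?M t z) / (2 * of_real pi * \<i>))) (at t within I)"
    by (intro tendsto_intros) auto
  moreover have "\<forall>\<^sub>F s in at t within I. - (contour_integral ?c (\<lambda>z. E s z / ?M s z) / (2 * of_real pi * \<i>)) =
     ((\<Sum>i\<in>K. w i s) - (\<Sum>i\<in>K. w i t)) / of_real (s - t)"
    using integral
  proof eventually_elim
    case (elim s)
    \<comment> \<open>The residue measures the displacement from the moving roots back to
      \<open>a\<close>, whence the minus sign in the velocity.\<close>
    have "(\<Sum>i\<in>K. a - w i s) = (\<Sum>i\<in>K. w i t) - (\<Sum>i\<in>K. w i s)"
      using w0 by (simp add: sum_subtractf)
    then show ?case
      using contour_integral_unique[OF elim] by (simp add: minus_divide_left del: of_real_diff)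
  qed
  ultimately show ?thesis
    unfolding has_vector_derivative_iff_quotient by (rule Lim_transform_eventually)
qed

text \<open>With \<open>G z = z * R z\<close>, the product rule gives
  \<open>(g G)' / g = G' + G g' / g\<close>, which equals \<open>Q / (N D)\<close> on
  \<open>T\<close> minus the finite set \<open>X\<close>. The complement of \<open>X\<close> is
  connected, so the identity continues to it. Around the circle \<open>G'\<close> integrates to 0,
  and the other term leaves the residue at \<open>a\<close>, the only possible singularity
  inside.\<close>

lemma contour_integral_eq_res_term:
  fixes N D A B Q :: "complex poly"
  defines "X \<equiv> {z. poly N z = 0 \<or> poly D z = 0 \<or> poly B z = 0}"
  assumes nz: "N \<noteq> 0" "D \<noteq> 0" "B \<noteq> 0" and "r > 0" and avoid: "cball a r - {a} \<subseteq> - X"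
    and R: "\<And>z. R z = poly A z / poly B z" and g: "\<And>z. g z = poly N z / poly D z"
    and T: "open T" "T \<noteq> {}"
    and Q: "\<And>z. z \<in> T \<Longrightarrow> poly Q z = (poly D z)\<^sup>2 * deriv (\<lambda>w. w * g w * R w) z"
  shows "contour_integral (circlepath a r) (\<lambda>z. poly Q z / (poly N z * poly D z)) = 2 * of_real pi * \<i> * res_term R g a"
proof -
  define \<phi> where "\<phi> = (\<lambda>z. poly Q z / (poly N z * poly D z))"
  define F where "F = (\<lambda>z. z * R z * (deriv g z / g z))"
  define G where "G = (\<lambda>z. z * R z)"
  have "X = {z. poly N z = 0} \<union> {z. poly D z = 0} \<union> {z. poly B z = 0}"
    by (auto simp: X_def)
  then have fin: "finite X" using nz by (simp add: poly_roots_finite)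
  then have op: "open (- X)" by (simp add: finite_imp_closed open_Compl)
  have gh: "g holomorphic_on - X" unfolding g[abs_def] by (intro holomorphic_intros) (auto simp: X_def)
  have Rh: "R holomorphic_on - X" unfolding R[abs_def] by (intro holomorphic_intros) (auto simp: X_def)
  have g0: "g z \<noteq> 0" if "z \<in> - X" for z using that by (auto simp: g X_def)
  have Fh: "F holomorphic_on - X" unfolding F_def
    by (intro holomorphic_intros gh Rh holomorphic_deriv op) (use g0 in auto)
  have Gh: "G holomorphic_on - X" unfolding G_def by (intro holomorphic_intros Rh)
  have \<phi>h: "\<phi> holomorphic_on - X" unfolding \<phi>_def by (intro holomorphic_intros) (auto simp: X_def)
  have eq: "\<phi> z = deriv G z + F z" if "z \<in> - X" for z
  proof (rule analytic_continuation_open[of "T - X" "- X" \<phi>, OF _ op _ _ _ \<phi>h _ _ that])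
    show "open (T - X)" using T(1) op by (simp add: Diff_eq open_Int)
    have "infinite T" using T finite_imp_not_open by blast
    then have "infinite (T - X)" using fin by simp
    then show "T - X \<noteq> {}" by force
    show "connected (- X)"
      using connected_open_delete_finite[of UNIV X] fin connected_UNIV by (simp add: Compl_eq_Diff_UNIV)
    show "(\<lambda>z. deriv G z + F z) holomorphic_on - X"
      by (intro holomorphic_intros Fh holomorphic_deriv Gh op)
    fix z assume z: "z \<in> T - X"
    have dg: "g field_differentiable at z" and dG: "G field_differentiable at z"
      using z gh Gh op by (auto intro: holomorphic_on_imp_differentiable_at)
    have "deriv (\<lambda>w. w * g w * R w) z = deriv (\<lambda>w. g w * G w) z"
      by (simp add: G_def mult_ac)
    also have "\<dots> = g z * deriv G z + deriv g z * G z"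
      using dg dG by simp
    finally have "poly Q z = (poly D z)\<^sup>2 * (g z * deriv G z + deriv g z * G z)"
      using Q z by simp
    moreover have "poly N z \<noteq> 0" "poly D z \<noteq> 0" using z by (auto simp: X_def)
    ultimately have "\<phi> z = (g z * deriv G z + deriv g z * G z) / g z"
      by (simp add: \<phi>_def g power2_eq_square)
    then show "\<phi> z = deriv G z + F z"
      using g0[of z] z by (simp add: F_def G_def add_divide_distrib mult.commute)
  qed auto
  have img: "path_image (circlepath a r) \<subseteq> - X"
    using avoid \<open>r > 0\<close> by auto
  have 1: "(F has_contour_integral 2 * pi * \<i> * residue F a) (circlepath a r)"
  proof (rule base_residue)
    have "insert a (- X) = - (X - {a})" by auto
    then show "open (insert a (- X))"
      using fin by (metis finite_Diff finite_imp_closed open_Compl)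
    show "F holomorphic_on insert a (- X) - {a}" using Fh by (rule holomorphic_on_subset) auto
    show "cball a r \<subseteq> insert a (- X)" using avoid by auto
  qed (use \<open>r > 0\<close> in auto)
  have 2: "(deriv G has_contour_integral (G (pathfinish (circlepath a r)) - G (pathstart (circlepath a r)))) (circlepath a r)"
  proof (rule contour_integral_primitive)
    show "(G has_field_derivative deriv G x) (at x within - X)" if "x \<in> - X" for x
      using holomorphic_derivI[OF Gh op that] .
  qed (use img in auto)
  have "(\<phi> has_contour_integral 0 + 2 * pi * \<i> * residue F a) (circlepath a r)"
    by (rule has_contour_integral_eq[OF has_contour_integral_add[OF 2[simplified] 1]]) (use eq img in auto)
  then show ?thesis
    by (simp add: contour_integral_unique \<phi>_def F_def res_term_def)
qed

subsection \<open>Motion of zeros and poles\<close>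

definition zero_poly :: "nat \<Rightarrow> (real \<Rightarrow> complex) \<Rightarrow> (nat \<Rightarrow> real \<Rightarrow> complex) \<Rightarrow> real \<Rightarrow> complex poly" where
  "zero_poly m b \<omega> s = smult (b s) (\<Prod>k=1..m. [:- \<omega> k s, 1:])"

text \<open>The poles are grouped by their orders because continuity in time is available for
  \<open>p 1, ..., p l\<close> only.\<close>

definition pole_poly :: "nat \<Rightarrow> (nat \<Rightarrow> nat) \<Rightarrow> (nat \<Rightarrow> real \<Rightarrow> complex) \<Rightarrow> real \<Rightarrow> complex poly" where
  "pole_poly l \<nu> p s = (\<Prod>j=1..l. [:- p j s, 1:] ^ \<nu> j)"

lemma poly_zero_poly: "poly (zero_poly m b \<omega> s) z = b s * (\<Prod>k=1..m. z - \<omega> k s)"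
  by (simp add: zero_poly_def poly_prod)

lemma poly_pole_poly: "poly (pole_poly l \<nu> p s) z = (\<Prod>j=1..l. (z - p j s) ^ \<nu> j)"
  by (simp add: pole_poly_def poly_prod)

lemma degree_zero_poly: "degree (zero_poly m b \<omega> s) \<le> m"
proof -
  have "degree (\<Prod>k=1..m. [:- \<omega> k s, 1:]) \<le> (\<Sum>k=1..m. degree [:- \<omega> k s, 1:])"
    by (rule order.trans[OF degree_prod_sum_le]) auto
  then show ?thesis
    unfolding zero_poly_def by (intro order.trans[OF degree_smult_le]) simp
qed

lemma degree_pole_poly: "degree (pole_poly l \<nu> p s) \<le> (\<Sum>j=1..l. \<nu> j)"
proof -
  have "degree (pole_poly l \<nu> p s) \<le> (\<Sum>j=1..l. degree ([:- p j s, 1:] ^ \<nu> j))"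
    unfolding pole_poly_def by (rule order.trans[OF degree_prod_sum_le]) auto
  also have "\<dots> \<le> (\<Sum>j=1..l. \<nu> j)"
    by (intro sum_mono order.trans[OF degree_power_le]) simp
  finally show ?thesis .
qed

text \<open>The index classes of the distinct poles are disjoint and their sizes add up to
  \<open>n\<close>, so they exhaust all indices.\<close>

lemma poles_repeat:
  assumes rd: "rational_derivative I f m n l \<nu> b \<omega> p" and "t \<in> I" and "j \<in> {1..n}"
  obtains i where "i \<in> {1..l}" "p j t = p i t"
proof -
  let ?C = "\<lambda>j. {i\<in>{1..n}. p i t = p j t}"
  note rd = rd[unfolded rational_derivative_def]
  have sum: "(\<Sum>j=1..l. \<nu> j) = n" using rd by blast
  have inj: "inj_on (\<lambda>j. p j t) {1..l}" and card: "\<And>j. j \<in> {1..l} \<Longrightarrow> card (?C j) = \<nu> j"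
    using rd \<open>t \<in> I\<close> by blast+
  have disj: "\<forall>i\<in>{1..l}. \<forall>j\<in>{1..l}. i \<noteq> j \<longrightarrow> ?C i \<inter> ?C j = {}"
    using inj_onD[OF inj] by fastforce
  have "card (\<Union>j\<in>{1..l}. ?C j) = (\<Sum>j\<in>{1..l}. card (?C j))"
    by (rule card_UN_disjoint[OF finite_atLeastAtMost _ disj]) simp
  also have "\<dots> = n" using card sum by simp
  finally have "(\<Union>j\<in>{1..l}. ?C j) = {1..n}"
    by (intro card_subset_eq[OF finite_atLeastAtMost]) auto
  then show ?thesis using that \<open>j \<in> {1..n}\<close> by blast
qed

context
  fixes I q f m n l \<nu> b \<omega> p t
  assumes sol: "locally_univalent_solution I q f"
    and rd: "rational_derivative I f m n l \<nu> b \<omega> p"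
    and t: "t \<in> I"
begin

private abbreviation "N \<equiv> zero_poly m b \<omega>"
private abbreviation "D \<equiv> pole_poly l \<nu> p"

lemma distinct_poles_le: "{1..l} \<subseteq> {1..n}"
proof -
  have "l = (\<Sum>j=1..l. 1)" by simp
  also have "\<dots> \<le> (\<Sum>j=1..l. \<nu> j)"
    using rd by (intro sum_mono) (auto simp: rational_derivative_def)
  also have "\<dots> = n" using rd by (auto simp: rational_derivative_def)
  finally show ?thesis by auto
qed

lemma b_nz: "b t \<noteq> 0"
  using rd t unfolding rational_derivative_def by blast

lemma rat_g_eq_poly: "s \<in> I \<Longrightarrow> rat_g m n b \<omega> p z s = poly (N s) z / poly (D s) z"
  by (simp add: rat_g_distinct_poles[OF rd] poly_zero_poly poly_pole_poly)

lemma pole_poly_nonzero: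
  assumes "s \<in> I" "z \<in> cball 0 1"
  shows "poly (D s) z \<noteq> 0"
proof -
  have "z \<noteq> p j s" if "j \<in> {1..l}" for j
  proof -
    have "1 < cmod (p j s)"
      using rd assms(1) that distinct_poles_le unfolding rational_derivative_def by blast
    then show ?thesis using assms(2) by auto
  qed
  then show ?thesis by (simp add: poly_pole_poly)
qed

lemma deriv_eq_poly: "s \<in> I \<Longrightarrow> z \<in> cball 0 1 \<Longrightarrow> deriv (\<lambda>w. f w s) z = poly (N s) z / poly (D s) z"
  using rd by (simp add: rational_derivative_def flip: rat_g_eq_poly)

text \<open>Continuity of \<open>b\<close> is a consequence: 0 is neither a zero nor a pole, so
  \<open>b\<close> can be solved for in the product formula at \<open>z = 0\<close>, where
  \<open>f'\<close> is differentiable in time.\<close>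

lemma continuous_on_data:
  shows "k \<in> {1..m} \<Longrightarrow> continuous_on I (\<omega> k)" and "j \<in> {1..l} \<Longrightarrow> continuous_on I (p j)"
    and "continuous_on I b"
proof -
  show 1: "continuous_on I (\<omega> k)" if "k \<in> {1..m}" for k
    using that rd by (auto simp: rational_derivative_def)
  show 2: "continuous_on I (p j)" if "j \<in> {1..l}" for j
    using that rd by (auto simp: rational_derivative_def)
  have \<omega>: "(\<Prod>k=1..m. 0 - \<omega> k s) \<noteq> 0" if "s \<in> I" for s
    using that rd unfolding rational_derivative_def by force
  have g: "continuous_on I (\<lambda>s. deriv (\<lambda>w. f w s) 0)"
    unfolding continuous_on_eq_continuous_within
    using tderiv_deriv[OF sol, of _ 0] by (auto intro: has_vector_derivative_continuous)
  have "continuous_on I (\<lambda>s. deriv (\<lambda>w. f w s) 0 * (\<Prod>j=1..l. (0 - p j s) ^ \<nu> j) / (\<Prod>k=1..m. 0 - \<omega> k s))"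
    using \<omega> by (intro continuous_intros g 1 2) auto
  then show "continuous_on I b"
  proof (rule continuous_on_eq)
    fix s assume s: "s \<in> I"
    show "deriv (\<lambda>w. f w s) 0 * (\<Prod>j=1..l. (0 - p j s) ^ \<nu> j) / (\<Prod>k=1..m. 0 - \<omega> k s) = b s"
      using pole_poly_nonzero[OF s, of 0] \<omega>[OF s] deriv_eq_poly[OF s, of 0]
      by (simp add: poly_zero_poly poly_pole_poly)
  qed
qed

text \<open>On the disk the polynomial is the difference quotient of \<open>f'\<close> in time
  multiplied by \<open>D s * D t\<close>, so it converges there pointwise. Its degree is at most
  \<open>m + n\<close>, and interpolation carries the convergence to compact sets of the plane,
  where the zeros and poles lie.\<close>

lemma poly_quotient_limit:
  "\<exists>Q. (\<forall>S. compact S \<longrightarrow> uniform_limit S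
       (\<lambda>s. poly (smult (1 / of_real (s - t)) (N s * D t - N t * D s))) (poly Q) (at t within I)) \<and>
     (\<forall>z\<in>ball 0 1. poly Q z = (poly (D t) z)\<^sup>2 * deriv (\<lambda>w. tderiv I f w t) z)"
proof -
  let ?E = "\<lambda>s. smult (1 / complex_of_real (s - t)) (N s * D t - N t * D s)"
  have deg: "degree (?E s) \<le> m + n" for s
  proof -
    have "degree (D s) \<le> n" for s
      using degree_pole_poly[of l \<nu> p s] rd by (auto simp: rational_derivative_def)
    then show ?thesis
      by (intro order.trans[OF degree_smult_le] degree_diff_le order.trans[OF degree_mult_le] add_mono degree_zero_poly)
  qed
  have lim: "((\<lambda>s. poly (?E s) z) \<longlongrightarrow> (poly (D t) z)\<^sup>2 * deriv (\<lambda>w. tderiv I f w t) z) (at t within I)"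
    if z: "z \<in> ball 0 1" for z
  proof -
    have zc: "z \<in> cball 0 1" using z by auto
    have "continuous_on I (\<lambda>s. poly (D s) z)"
      unfolding poly_pole_poly by (intro continuous_intros continuous_on_data)
    then have "((\<lambda>s. poly (D s) z) \<longlongrightarrow> poly (D t) z) (at t within I)"
      using t by (simp add: continuous_on)
    then have "((\<lambda>s. (deriv (\<lambda>w. f w s) z - deriv (\<lambda>w. f w t) z) / of_real (s - t) * (poly (D s) z * poly (D t) z)) \<longlongrightarrow>
        deriv (\<lambda>w. tderiv I f w t) z * (poly (D t) z * poly (D t) z)) (at t within I)"
      using tderiv_deriv[OF sol t z] unfolding has_vector_derivative_iff_quotient
      by (intro tendsto_intros)
    moreover have "\<forall>\<^sub>F s in at t within I.
      (deriv (\<lambda>w. f w s) z - deriv (\<lambda>w. f w t) z) / of_real (s - t) * (poly (D s) z * poly (D t) z) = poly (?E s) z"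
      unfolding eventually_at_filter
    proof (intro always_eventually allI impI)
      fix s assume "s \<noteq> t" "s \<in> I"
      then show "(deriv (\<lambda>w. f w s) z - deriv (\<lambda>w. f w t) z) / of_real (s - t) * (poly (D s) z * poly (D t) z) = poly (?E s) z"
        using pole_poly_nonzero[OF t zc] pole_poly_nonzero[OF \<open>s \<in> I\<close> zc]
        by (simp add: deriv_eq_poly[OF _ zc] t field_simps)
    qed
    ultimately show ?thesis
      by (simp add: power2_eq_square mult_ac Lim_transform_eventually)
  qed
  \<comment> \<open>One node more than the degree bound, all of them inside the disk.\<close>
  obtain A where A: "A \<subseteq> ball (0::complex) 1" "finite A" "card A = Suc (m + n)"
  proof -
    have "infinite (ball (0::complex) 1)"
      using finite_imp_not_open[of "ball (0::complex) 1"] by auto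
    then show ?thesis using infinite_arbitrarily_large that by blast
  qed
  have deg': "degree (?E s) < card A" for s
    using deg[of s] A by simp
  obtain Q where Q: "\<And>S. compact S \<Longrightarrow> uniform_limit S (\<lambda>s. poly (?E s)) (poly Q) (at t within I)"
    using uniform_limit_poly_interpolation[OF \<open>finite A\<close> deg' lim] A by blast
  moreover have "poly Q z = (poly (D t) z)\<^sup>2 * deriv (\<lambda>w. tderiv I f w t) z" if "z \<in> ball 0 1" for z
  proof (rule tendsto_unique[OF _ _ lim[OF that]])
    show "at t within I \<noteq> bot"
      using at_within_interval_neq_bot sol t by (auto simp: locally_univalent_solution_def)
    show "((\<lambda>s. poly (?E s) z) \<longlongrightarrow> poly Q z) (at t within I)"
      using tendsto_uniform_limitI[OF Q[of "{z}"]] by auto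
  qed
  ultimately show ?thesis by blast
qed

text \<open>Near a zero or pole \<open>a\<close>, \<open>N s * D t - N t * D s\<close> splits into a
  moving factor concentrated at \<open>a\<close> at time \<open>t\<close> and a cofactor without
  zeros nearby. The velocity of the roots of the moving factor is then a contour integral of
  \<open>Q / (N D)\<close>, that is, a residue.\<close>

lemma sum_zeros_poles_derivative:
  assumes R: "rational_extension q f t R" and g: "g = (\<lambda>z. rat_g m n b \<omega> p z t)"
  shows "k \<in> {1..m} \<Longrightarrow> ((\<lambda>s. \<Sum>i\<in>{i\<in>{1..m}. \<omega> i t = \<omega> k t}. \<omega> i s) has_vector_derivative
            - res_term R g (\<omega> k t)) (at t within I)"
    and "j \<in> {1..l} \<Longrightarrow> (p j has_vector_derivative res_term R g (p j t) / of_nat (\<nu> j)) (at t within I)"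
proof -
  obtain A B where B: "B \<noteq> 0" and R_eq: "\<And>z. R z = poly A z / poly B z"
    and LK: "\<And>z. z \<in> ball 0 1 \<Longrightarrow> R z = LK_P q f z t"
    using R unfolding rational_extension_def by blast
  have g_eq: "g z = poly (N t) z / poly (D t) z" for z
    using g rat_g_eq_poly[OF t] by simp
  have b: "b t \<noteq> 0" and \<nu>: "\<And>j. j \<in> {1..l} \<Longrightarrow> \<nu> j \<ge> 1"
    and inj: "inj_on (\<lambda>j. p j t) {1..l}"
    and ne: "\<And>k j. k \<in> {1..m} \<Longrightarrow> j \<in> {1..l} \<Longrightarrow> \<omega> k t \<noteq> p j t"
    using rd t distinct_poles_le unfolding rational_derivative_def by blast+
  have N0: "poly (N t) z = 0 \<longleftrightarrow> (\<exists>k\<in>{1..m}. z = \<omega> k t)" for z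
    using b by (auto simp: poly_zero_poly)
  have D0: "poly (D t) z = 0 \<longleftrightarrow> (\<exists>j\<in>{1..l}. z = p j t)" for z
    using \<nu> by (force simp: poly_pole_poly)
  have nz: "N t \<noteq> 0" "D t \<noteq> 0"
    using b by (auto simp: zero_poly_def pole_poly_def)
  have nb: "at t within I \<noteq> bot"
    using at_within_interval_neq_bot sol t by (auto simp: locally_univalent_solution_def)
  obtain Q where Q: "\<And>S. compact S \<Longrightarrow> uniform_limit S
       (\<lambda>s. poly (smult (1 / of_real (s - t)) (N s * D t - N t * D s))) (poly Q) (at t within I)"
    and Q_eq: "\<And>z. z \<in> ball 0 1 \<Longrightarrow> poly Q z = (poly (D t) z)\<^sup>2 * deriv (\<lambda>w. tderiv I f w t) z"
    using poly_quotient_limit by blast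
  \<comment> \<open>On the disk the Loewner-Kufarev equation replaces the time derivative by an
    expression that is rational in \<open>w\<close>.\<close>
  have Q_eq': "poly Q z = (poly (D t) z)\<^sup>2 * deriv (\<lambda>w. w * g w * R w) z" if z: "z \<in> ball 0 1" for z
  proof -
    have "\<forall>\<^sub>F w in nhds z. w \<in> ball 0 1"
      using z by (intro eventually_nhds_in_open) auto
    then have "\<forall>\<^sub>F w in nhds z. tderiv I f w t = w * g w * R w"
    proof eventually_elim
      case (elim w)
      then show ?case
        using Loewner_Kufarev[OF sol t elim] deriv_eq_poly[OF t, of w] LK[OF elim] by (simp add: g_eq)
    qed
    then show ?thesis using Q_eq[OF z] by (simp add: deriv_cong_ev)
  qed
  define X where "X = {z. poly (N t) z = 0 \<or> poly (D t) z = 0 \<or> poly B z = 0}"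
  have "X = {z. poly (N t) z = 0} \<union> {z. poly (D t) z = 0} \<union> {z. poly B z = 0}"
    by (auto simp: X_def)
  then have fin: "finite X" using nz B by (simp add: poly_roots_finite)
  have radius: "\<exists>r>0. cball a r - {a} \<subseteq> - X" for a
  proof -
    obtain d where "d > 0" "\<forall>x\<in>X. x \<noteq> a \<longrightarrow> d \<le> dist a x"
      using finite_set_avoid[OF fin] by blast
    then show ?thesis by (intro exI[of _ "d/2"]) force
  qed
  have ne_ball: "ball (0::complex) 1 \<noteq> {}" by simp
  have ci: "contour_integral (circlepath a r) (\<lambda>z. poly Q z / (poly (N t) z * poly (D t) z)) =
      2 * of_real pi * \<i> * res_term R g a" if "r > 0" "cball a r - {a} \<subseteq> - X" for a r
    using contour_integral_eq_res_term[OF nz B that(1) that(2)[unfolded X_def] R_eq g_eq open_ball ne_ball Q_eq'] .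
  have snd_cont: "continuous_on S (\<lambda>x. h (fst x))" if "continuous_on I h" "\<And>x. x \<in> S \<Longrightarrow> fst x \<in> I"
    for S :: "(real \<times> complex) set" and h :: "real \<Rightarrow> complex"
    using that by (intro continuous_on_compose2[OF that(1)] continuous_intros) auto
  {
    assume k: "k \<in> {1..m}"
    define a where "a = \<omega> k t"
    define K where "K = {i\<in>{1..m}. \<omega> i t = a}"
    obtain r where r: "r > 0" "cball a r - {a} \<subseteq> - X" using radius by blast
    \<comment> \<open>\<open>N s\<close> contributes the moving factor over the cluster
      \<open>K\<close>, while in \<open>N t\<close> this factor is
      \<open>(z - a) ^ card K\<close>.\<close>
    define U where "U = (\<lambda>s z. b s * (\<Prod>i\<in>{1..m} - K. z - \<omega> i s) * poly (D t) z)"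
    define V where "V = (\<lambda>s z. b t * (\<Prod>i\<in>{1..m} - K. z - \<omega> i t) * poly (D s) z)"
    have N_split: "poly (N s) z = b s * ((\<Prod>i\<in>K. z - \<omega> i s) * (\<Prod>i\<in>{1..m} - K. z - \<omega> i s))" for s z
      unfolding poly_zero_poly
      by (subst prod.subset_diff[of K "{1..m}"]) (auto simp: K_def mult.commute)
    have K_t: "(\<Prod>i\<in>K. z - \<omega> i t) = (z - a) ^ card K" for z
      by (simp add: K_def)
    have "((\<lambda>s. \<Sum>i\<in>K. \<omega> i s) has_vector_derivative
      - (contour_integral (circlepath a r) (\<lambda>z. poly Q z / ((z - a) ^ card K * U t z)) / (2 * of_real pi * \<i>)))
      (at t within I)"
    proof (rule has_vector_derivative_sum_roots[where V = V, OF _ \<open>r > 0\<close> t nb _ _ Q])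
      show "of_real (s - t) * poly (smult (1 / of_real (s - t)) (N s * D t - N t * D s)) z =
          (\<Prod>i\<in>K. z - \<omega> i s) * U s z - (z - a) ^ card K * V s z" if "s \<in> I" "s \<noteq> t" for s z
        using that by (simp add: U_def V_def N_split K_t mult_ac flip: of_real_diff)
      show "continuous_on (I \<times> cball a r) (\<lambda>(s, z). U s z)"
        unfolding U_def case_prod_unfold
        by (intro continuous_intros snd_cont continuous_on_data) auto
      show "U t z \<noteq> 0" if z: "z \<in> cball a r" for z
      proof -
        have "z = a \<or> z \<notin> X" using z r(2) by auto
        then show ?thesis using b k ne D0[of z] N0[of z] by (auto simp: U_def X_def K_def a_def)
      qed
    qed (auto simp: K_def U_def V_def intro!: continuous_intros holomorphic_intros)
    moreover have "(z - a) ^ card K * U t z = poly (N t) z * poly (D t) z" for z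
      by (simp add: U_def N_split K_t)
    ultimately have "((\<lambda>s. \<Sum>i\<in>K. \<omega> i s) has_vector_derivative - res_term R g a) (at t within I)"
      using ci[OF r] by simp
    then show "((\<lambda>s. \<Sum>i\<in>{i\<in>{1..m}. \<omega> i t = \<omega> k t}. \<omega> i s) has_vector_derivative
            - res_term R g (\<omega> k t)) (at t within I)"
      by (simp add: K_def a_def)
  next
    assume j: "j \<in> {1..l}"
    define a where "a = p j t"
    obtain r where r: "r > 0" "cball a r - {a} \<subseteq> - X" using radius by blast
    \<comment> \<open>Now \<open>D s\<close> moves, and it stands in the subtracted product, so both
      cofactors carry a minus sign. The moving factor consists of \<open>\<nu> j\<close> equal
      copies, because the orders are fixed in time; the sum of its roots is
      \<open>\<nu> j * p j\<close>, and dividing yields the derivative of \<open>p j\<close>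
      itself.\<close>
    define U where "U = (\<lambda>s z. - poly (N t) z * (\<Prod>i\<in>{1..l} - {j}. (z - p i s) ^ \<nu> i))"
    define V where "V = (\<lambda>s z. - poly (N s) z * (\<Prod>i\<in>{1..l} - {j}. (z - p i t) ^ \<nu> i))"
    have D_split: "poly (D s) z = (z - p j s) ^ \<nu> j * (\<Prod>i\<in>{1..l} - {j}. (z - p i s) ^ \<nu> i)" for s z
      unfolding poly_pole_poly using j by (subst prod.remove[of _ j]) auto
    have "((\<lambda>s. \<Sum>i<\<nu> j. p j s) has_vector_derivative
      - (contour_integral (circlepath a r) (\<lambda>z. poly Q z / ((z - a) ^ card {..<\<nu> j} * U t z)) / (2 * of_real pi * \<i>)))
      (at t within I)"
    proof (rule has_vector_derivative_sum_roots[where V = V, OF _ \<open>r > 0\<close> t nb _ _ Q])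
      show "of_real (s - t) * poly (smult (1 / of_real (s - t)) (N s * D t - N t * D s)) z =
          (\<Prod>i<\<nu> j. z - p j s) * U s z - (z - a) ^ card {..<\<nu> j} * V s z" if "s \<in> I" "s \<noteq> t" for s z
        using that by (simp add: U_def V_def D_split a_def mult_ac flip: of_real_diff)
      show "continuous_on (I \<times> cball a r) (\<lambda>(s, z). U s z)"
        unfolding U_def case_prod_unfold
        by (intro continuous_intros snd_cont continuous_on_data) auto
      show "U t z \<noteq> 0" if z: "z \<in> cball a r" for z
      proof -
        have "z = a \<or> z \<notin> X" using z r(2) by auto
        have other: "p j t \<noteq> p i t" if "i \<in> {1..l} - {j}" for i
          using inj_onD[OF inj] that j by auto
        from \<open>z = a \<or> z \<notin> X\<close> have "(\<Prod>i\<in>{1..l} - {j}. (z - p i t) ^ \<nu> i) \<noteq> 0 \<and> poly (N t) z \<noteq> 0"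
        proof (elim disjE)
          assume "z = a"
          moreover have "p j t \<noteq> \<omega> k t" if "k \<in> {1..m}" for k
            using ne[OF that j] by simp
          then have "poly (N t) (p j t) \<noteq> 0" by (simp add: N0)
          ultimately show ?thesis using other by (simp add: a_def)
        next
          assume "z \<notin> X"
          then show ?thesis using D_split[of t z] by (auto simp: X_def)
        qed
        then show ?thesis by (simp add: U_def)
      qed
    qed (auto simp: a_def U_def V_def intro!: continuous_intros holomorphic_intros)
    moreover have "(z - a) ^ card {..<\<nu> j} * U t z = - (poly (N t) z * poly (D t) z)" for z
      by (simp add: U_def D_split a_def)
    ultimately have "((\<lambda>s. of_nat (\<nu> j) * p j s) has_vector_derivative res_term R g a) (at t within I)"
      using ci[OF r] by (simp add: contour_integral_neg)
    then have "((\<lambda>s. of_nat (\<nu> j) * p j s / of_nat (\<nu> j)) has_vector_derivative res_term R g a / of_nat (\<nu> j)) (at t within I)"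
      by (rule has_vector_derivative_divide)
    then show "(p j has_vector_derivative res_term R g (p j t) / of_nat (\<nu> j)) (at t within I)"
      using \<nu>[OF j] by (simp add: a_def)
  }
qed

text \<open>This translates the order of \<open>g\<close> into the size of a cluster of indices, the
  form in which the velocity formula is available.\<close>

lemma zorder_zero:
  assumes "k \<in> {1..m}"
  shows "zorder (\<lambda>z. rat_g m n b \<omega> p z t) (\<omega> k t) = int (card {i\<in>{1..m}. \<omega> i t = \<omega> k t})"
proof -
  define K where "K = {i\<in>{1..m}. \<omega> i t = \<omega> k t}"
  define h where "h = (\<lambda>z. b t * (\<Prod>i\<in>{1..m} - K. z - \<omega> i t) / poly (D t) z)"
  define S where "S = {z. poly (D t) z \<noteq> 0}"
  have "D t \<noteq> 0" by (auto simp: pole_poly_def)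
  have "zorder (\<lambda>z. rat_g m n b \<omega> p z t) (\<omega> k t) = int (card K)"
  proof (rule zorder_eqI[where S = S and g = h])
    have "S = - {z. poly (D t) z = 0}" by (auto simp: S_def)
    then show "open S" using poly_roots_finite[OF \<open>D t \<noteq> 0\<close>] by (simp add: finite_imp_closed open_Compl)
    have "\<omega> k t \<noteq> p j t" if "j \<in> {1..l}" for j
      using rd t distinct_poles_le assms that unfolding rational_derivative_def by blast
    then have "poly (D t) (\<omega> k t) \<noteq> 0"
      by (simp add: poly_pole_poly)
    then show "\<omega> k t \<in> S" by (simp add: S_def)
    show "h (\<omega> k t) \<noteq> 0"
      using b_nz \<open>poly (D t) (\<omega> k t) \<noteq> 0\<close> by (auto simp: h_def K_def)
    show "h holomorphic_on S" unfolding h_def by (intro holomorphic_intros) (auto simp: S_def)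
    show "rat_g m n b \<omega> p w t = h w * (w - \<omega> k t) powi int (card K)" for w
    proof -
      have "(\<Prod>i=1..m. w - \<omega> i t) = (\<Prod>i\<in>{1..m} - K. w - \<omega> i t) * (\<Prod>i\<in>K. w - \<omega> i t)"
        by (rule prod.subset_diff) (auto simp: K_def)
      also have "(\<Prod>i\<in>K. w - \<omega> i t) = (w - \<omega> k t) ^ card K"
        by (simp add: K_def)
      finally show ?thesis
        by (simp add: rat_g_eq_poly[OF t] poly_zero_poly h_def)
    qed
  qed
  then show ?thesis by (simp add: K_def)
qed

lemma zorder_pole:
  assumes j: "j \<in> {1..l}"
  shows "zorder (\<lambda>z. rat_g m n b \<omega> p z t) (p j t) = - int (\<nu> j)"
proof -
  define h where "h = (\<lambda>z. poly (N t) z / (\<Prod>i\<in>{1..l} - {j}. (z - p i t) ^ \<nu> i))"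
  have inj: "inj_on (\<lambda>j. p j t) {1..l}"
    using rd t unfolding rational_derivative_def by blast
  define S where "S = - (\<lambda>i. p i t) ` ({1..l} - {j})"
  show ?thesis
  proof (rule zorder_eqI[where S = S and g = h])
    show "open S" unfolding S_def by (intro open_Compl finite_imp_closed) auto
    show "p j t \<in> S"
      using inj j by (auto simp: S_def dest: inj_onD)
    have "p j t \<noteq> \<omega> k t" if "k \<in> {1..m}" for k
      using rd t distinct_poles_le j that unfolding rational_derivative_def by (metis subsetD)
    then have "poly (N t) (p j t) \<noteq> 0"
      using b_nz by (simp add: poly_zero_poly)
    then show "h (p j t) \<noteq> 0"
      using \<open>p j t \<in> S\<close> by (auto simp: h_def S_def)
    show "h holomorphic_on S" unfolding h_def by (intro holomorphic_intros) (auto simp: S_def)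
    show "rat_g m n b \<omega> p w t = h w * (w - p j t) powi - int (\<nu> j)" for w
      using j by (simp add: rat_g_eq_poly[OF t] poly_pole_poly h_def power_int_minus prod.remove[of _ j] divide_inverse)
  qed
qed

text \<open>A simple zero is a cluster with a single index and a simple pole has
  \<open>\<nu> = 1\<close>, so both simple cases are instances of the formulas for clusters and for
  multiple poles.\<close>

theorem zeros_poles_evolution:
  assumes R: "rational_extension q f t R" and g: "g = (\<lambda>z. rat_g m n b \<omega> p z t)"
  shows "(\<forall>k\<in>{1..m}. zorder g (\<omega> k t) = 1 \<longrightarrow>
             (\<omega> k has_vector_derivative - res_term R g (\<omega> k t)) (at t within I)) \<and>
          (\<forall>j\<in>{1..n}. zorder g (p j t) = - 1 \<longrightarrow>
             (p j has_vector_derivative res_term R g (p j t)) (at t within I)) \<and>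
          (\<forall>k\<in>{1..m}. zorder g (\<omega> k t) > 1 \<longrightarrow>
             ((\<lambda>s. \<Sum>i\<in>{i\<in>{1..m}. \<omega> i t = \<omega> k t}. \<omega> i s) has_vector_derivative
                - res_term R g (\<omega> k t)) (at t within I)) \<and>
          (\<forall>j\<in>{1..l}. \<exists>D. (p j has_vector_derivative D) (at t within I) \<and>
             of_nat (\<nu> j) * D = res_term R g (p j t))"
proof (intro conjI ballI impI)
  note zeros = sum_zeros_poles_derivative(1)[OF R g] and poles = sum_zeros_poles_derivative(2)[OF R g]
  have \<nu>: "\<nu> j \<ge> 1" "card {i\<in>{1..n}. p i t = p j t} = \<nu> j" if "j \<in> {1..l}" for j
    using rd t that unfolding rational_derivative_def by blast+
  show "(\<omega> k has_vector_derivative - res_term R g (\<omega> k t)) (at t within I)"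
    if k: "k \<in> {1..m}" "zorder g (\<omega> k t) = 1" for k
  proof -
    have "card {i\<in>{1..m}. \<omega> i t = \<omega> k t} = 1"
      using zorder_zero[OF k(1)] k(2) g by simp
    then obtain x where "{i\<in>{1..m}. \<omega> i t = \<omega> k t} = {x}"
      by (rule card_1_singletonE)
    moreover have "k \<in> {i\<in>{1..m}. \<omega> i t = \<omega> k t}"
      using k(1) by simp
    ultimately have "{i\<in>{1..m}. \<omega> i t = \<omega> k t} = {k}"
      by simp
    then show ?thesis using zeros[OF k(1)] by simp
  qed
  show "(p j has_vector_derivative res_term R g (p j t)) (at t within I)"
    if j: "j \<in> {1..n}" "zorder g (p j t) = - 1" for j
  proof -
    obtain i where i: "i \<in> {1..l}" "p j t = p i t" using poles_repeat[OF rd t j(1)] .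
    then have "\<nu> i = 1" using zorder_pole[OF i(1)] j(2) g by simp
    then have "card {i'\<in>{1..n}. p i' t = p i t} = 1" using \<nu>(2)[OF i(1)] by simp
    moreover have "i \<in> {i'\<in>{1..n}. p i' t = p i t}" "j \<in> {i'\<in>{1..n}. p i' t = p i t}"
      using i j distinct_poles_le by auto
    \<comment> \<open>A simple pole occurs only once in the full list, so an index \<open>j\<close>
      up to \<open>n\<close> is already one of the distinct ones.\<close>
    ultimately have "j = i" by (metis card_1_singletonE singletonD)
    then show ?thesis using poles[OF i(1)] \<open>\<nu> i = 1\<close> by simp
  qed
  show "((\<lambda>s. \<Sum>i\<in>{i\<in>{1..m}. \<omega> i t = \<omega> k t}. \<omega> i s) has_vector_derivative
      - res_term R g (\<omega> k t)) (at t within I)" if "k \<in> {1..m}" for k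
    using zeros[OF that] .
  show "\<exists>D. (p j has_vector_derivative D) (at t within I) \<and> of_nat (\<nu> j) * D = res_term R g (p j t)"
    if "j \<in> {1..l}" for j
    using poles[OF that] \<nu>(1)[OF that] by (intro exI[of _ "res_term R g (p j t) / of_nat (\<nu> j)"]) auto
qed

end

subsection \<open>A collision of zeros\<close>

text \<open>For a real cubic \<open>a\<^sub>1 z + a\<^sub>2 z\<^sup>2 + a\<^sub>3 z\<^sup>3\<close> the Polubarinova-Galin equation says, up to the
  choice of \<open>q\<close>, that \<open>a\<^sub>1\<^sup>3 a\<^sub>3\<close> and \<open>a\<^sub>2 a\<^sub>1 (a\<^sub>1 + 3 a\<^sub>3)\<close> are constant in time. The flow below takes
  \<open>a\<^sub>1 = t\<close> as the time variable and \<open>a\<^sub>1\<^sup>3 a\<^sub>3 = 1/3\<close>; the factor 17/8 makes the two zeros of the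
  derivative collide at time 2, at the point \<open>-4\<close>.\<close>

definition quad_coeff :: "real \<Rightarrow> real" where
  "quad_coeff t = 17/8 * t\<^sup>2 / (t^4 + 1)"

definition quad_coeff' :: "real \<Rightarrow> real" where
  "quad_coeff' t = 17/4 * t * (1 - t^4) / (t^4 + 1)\<^sup>2"

definition cubic_flow :: "complex \<Rightarrow> real \<Rightarrow> complex" where
  "cubic_flow z t = of_real t * z + of_real (quad_coeff t) * z\<^sup>2 + of_real (1 / (3 * t^3)) * z^3"

text \<open>A quarter of the discriminant of the derivative of the flow as a quadratic in
  \<open>z\<close>.\<close>

definition disc :: "real \<Rightarrow> real" where
  "disc t = (quad_coeff t)\<^sup>2 - 1 / t\<^sup>2"

text \<open>A square root of \<open>disc\<close>, real or purely imaginary according to its sign.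
  Writing both parts with \<open>max\<close> makes it continuous through the sign change, as the
  zeros have to be.\<close>

definition sqrt_disc :: "real \<Rightarrow> complex" where
  "sqrt_disc t = Complex (sqrt (max (disc t) 0)) (sqrt (max (- disc t) 0))"

text \<open>The quadratic formula; every index other than 1 denotes the second root.\<close>

definition crit :: "nat \<Rightarrow> real \<Rightarrow> complex" where
  "crit k t = of_real (t^3) * (- of_real (quad_coeff t) + (if k = 1 then 1 else - 1) * sqrt_disc t)"

lemma quartic_pos: "(t::real)^4 + 1 > 0"
proof -
  have "t^4 \<ge> 0" by (rule zero_le_even_power) simp
  then show ?thesis by linarith
qed

lemma sqrt_disc_squared: "(sqrt_disc t)\<^sup>2 = of_real (disc t)"
  by (cases "disc t \<ge> 0") (auto simp: sqrt_disc_def complex_eq_iff power2_eq_square)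

lemma quad_coeff_deriv: "(quad_coeff has_real_derivative quad_coeff' t) (at t within S)"
proof -
  have "t^4 + 1 \<noteq> 0" using quartic_pos[of t] by simp
  then show ?thesis
    unfolding quad_coeff_def quad_coeff'_def
    by (auto intro!: derivative_eq_intros simp: divide_simps) (simp add: algebra_simps eval_nat_numeral)
qed

lemma continuous_on_quad_coeff: "continuous_on S quad_coeff"
  using quad_coeff_deriv by (intro DERIV_continuous_on)

lemma continuous_on_quad_coeff': "continuous_on S quad_coeff'"
  unfolding quad_coeff'_def using quartic_pos by (intro continuous_intros) (auto simp: less_imp_neq[symmetric])

text \<open>The left-hand side is \<open>1 / t\<close> times the time derivative of
  \<open>quad_coeff t * (t^2 + 1 / t^2)\<close>, which has the constant value 17/8.\<close>

lemma quad_coeff_ode: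
  assumes "t > 0"
  shows "2 * quad_coeff t + quad_coeff' t * t + quad_coeff' t / t^3 - 2 * quad_coeff t / t^4 = 0"
proof -
  have e: "t^4 + 1 \<noteq> 0" "t \<noteq> 0" using quartic_pos[of t] assms by auto
  have a: "quad_coeff' t * t + quad_coeff' t / t^3 = quad_coeff' t * (t^4 + 1) / t^3"
    using e by (simp add: field_simps eval_nat_numeral)
  have b: "2 * quad_coeff t - 2 * quad_coeff t / t^4 = 2 * quad_coeff t * (t^4 - 1) / t^4"
    using e by (simp add: field_simps)
  have "quad_coeff' t * (t^4 + 1) / t^3 = 17/4 * (1 - t^4) / (t^2 * (t^4 + 1))"
    using e by (simp add: quad_coeff'_def divide_simps) (simp add: eval_nat_numeral algebra_simps)
  moreover have "2 * quad_coeff t * (t^4 - 1) / t^4 = 17/4 * (t^4 - 1) / (t^2 * (t^4 + 1))"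
    using e by (simp add: quad_coeff_def divide_simps) (simp add: eval_nat_numeral algebra_simps)
  moreover have "17/4 * (1 - t^4) / (t^2 * (t^4 + 1)) = - (17/4 * (t^4 - 1) / (t^2 * (t^4 + 1)))"
  proof -
    have "17/4 * (1 - t^4) = - (17/4 * (t^4 - 1))" by (simp add: field_simps)
    then show ?thesis by (simp only: minus_divide_left)
  qed
  ultimately show ?thesis using a b by linarith
qed

lemma disc_2: "disc 2 = 0"
  by (simp add: disc_def quad_coeff_def power2_eq_square)

lemma disc_deriv_2: "(disc has_real_derivative - 13/68) (at 2)"
proof -
  have "((\<lambda>t. (quad_coeff t)\<^sup>2 - 1 / t\<^sup>2) has_real_derivative - 13/68) (at 2)"
    by (rule derivative_eq_intros quad_coeff_deriv refl | simp)+
      (simp add: quad_coeff_def quad_coeff'_def power2_eq_square)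
  then show ?thesis by (simp add: disc_def[abs_def])
qed

lemma continuous_on_crit:
  assumes "S \<subseteq> {0<..}"
  shows "continuous_on S (crit k)"
proof -
  have "continuous_on S disc"
    unfolding disc_def using assms by (intro continuous_intros continuous_on_quad_coeff) auto
  then have "continuous_on S sqrt_disc"
    unfolding sqrt_disc_def Complex_eq by (intro continuous_intros)
  then show ?thesis
    unfolding crit_def by (intro continuous_intros continuous_on_quad_coeff)
qed

section \<open>The cubic flow as a locally univalent solution\<close>

lemma deriv_cubic_flow:
  "deriv (\<lambda>w. cubic_flow w t) z = of_real t + 2 * of_real (quad_coeff t) * z + of_real (1 / t^3) * z\<^sup>2"
proof -
  have "((\<lambda>w. a * w + b * w\<^sup>2 + c * w^3) has_field_derivative a + 2 * b * z + 3 * c * z\<^sup>2) (at z)"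
    for a b c
    by (auto intro!: derivative_eq_intros)
  from DERIV_imp_deriv[OF this[of "of_real t" "of_real (quad_coeff t)" "of_real (1 / (3 * t^3))"]]
  show ?thesis
    by (simp add: cubic_flow_def)
qed

lemma deriv_cubic_flow_factored:
  assumes "t > 0"
  shows "deriv (\<lambda>w. cubic_flow w t) z = of_real (1 / t^3) * ((z - crit 1 t) * (z - crit 2 t))"
proof -
  let ?a = "complex_of_real (quad_coeff t)" and ?t = "complex_of_real t"
  have t: "?t \<noteq> 0" using assms by simp
  have "(z - crit 1 t) * (z - crit 2 t) = (z + ?t^3 * ?a)\<^sup>2 - ?t^6 * (sqrt_disc t)\<^sup>2"
    by (simp add: crit_def algebra_simps eval_nat_numeral)
  also have "\<dots> = z\<^sup>2 + 2 * ?t^3 * ?a * z + ?t^6 / ?t\<^sup>2"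
    unfolding sqrt_disc_squared disc_def by (simp add: algebra_simps eval_nat_numeral)
  also have "?t^6 / ?t\<^sup>2 = ?t^4"
    using t by (simp add: eval_nat_numeral)
  finally show ?thesis
    unfolding deriv_cubic_flow using assms
    by (simp add: divide_simps) (simp add: algebra_simps eval_nat_numeral)
qed

lemma cubic_flow_has_vector_derivative:
  assumes "t > 0"
  shows "((\<lambda>s. cubic_flow z s) has_vector_derivative
    z + of_real (quad_coeff' t) * z\<^sup>2 - of_real (1 / t^4) * z^3) (at t within S)"
proof -
  have "((\<lambda>s. 1 / (3 * s^3)) has_real_derivative - (1 / t^4)) (at t within S)"
    using assms by (auto intro!: derivative_eq_intros simp: field_simps eval_nat_numeral)
  from this[unfolded has_real_derivative_iff_has_vector_derivative]
  have c: "((\<lambda>s. of_real (1 / (3 * s^3))) has_vector_derivative complex_of_real (- (1 / t^4))) (at t within S)"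
    by (rule bounded_linear.has_vector_derivative[OF bounded_linear_of_real])
  have b: "((\<lambda>s. of_real (quad_coeff s)) has_vector_derivative complex_of_real (quad_coeff' t)) (at t within S)"
    using quad_coeff_deriv[unfolded has_real_derivative_iff_has_vector_derivative]
    by (rule bounded_linear.has_vector_derivative[OF bounded_linear_of_real])
  have a: "((\<lambda>s. of_real s) has_vector_derivative complex_of_real 1) (at t within S)"
    by (intro bounded_linear.has_vector_derivative[OF bounded_linear_of_real] derivative_intros)
  have "((\<lambda>s. cubic_flow z s) has_vector_derivative
    of_real 1 * z + of_real (quad_coeff' t) * z\<^sup>2 + of_real (- (1 / t^4)) * z^3) (at t within S)"
    unfolding cubic_flow_def
    by (intro has_vector_derivative_add has_vector_derivative_mult_left a b c)
  then show ?thesis by simp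
qed

text \<open>On the circle \<open>cnj z\<close> is the inverse of \<open>z\<close>, so the product is
  a Laurent polynomial. As \<open>cnj z\<close> and \<open>z\<close> have equal real parts, its real
  part is a constant plus multiples of \<open>Re z\<close> and \<open>Re (z^2)\<close>, and
  \<open>c1\<close> and \<open>c2\<close> cancel these two.\<close>

lemma Polubarinova_Galin_cubic:
  fixes z :: complex and t \<alpha> d e \<beta> :: real
  assumes "cmod z = 1" and c1: "2 * \<alpha> + d * t + d * \<beta> - 2 * \<alpha> * e = 0" and c2: "\<beta> = e * t"
  shows "Re ((z + of_real d * z\<^sup>2 - of_real e * z^3) *
      cnj (z * (of_real t + 2 * of_real \<alpha> * z + of_real \<beta> * z\<^sup>2))) = t + 2 * \<alpha> * d - e * \<beta>"
proof -
  define w where "w = cnj z"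
  have zw: "z * w = 1" using assms(1) by (simp add: w_def complex_norm_square[symmetric])
  have Re_w: "Re w = Re z" "Re (w\<^sup>2) = Re (z\<^sup>2)"
    by (simp_all add: w_def power2_eq_square)
  have "(z + of_real d * z\<^sup>2 - of_real e * z^3) * (w * (of_real t + 2 * of_real \<alpha> * w + of_real \<beta> * w\<^sup>2)) =
    of_real t * (z * w) + 2 * of_real \<alpha> * of_real d * (z * w)^2 - of_real e * of_real \<beta> * (z * w)^3
    + (z * w) * (2 * of_real \<alpha> * w) + (z * w)^2 * (of_real d * of_real \<beta> * w)
    + (z * w) * (of_real d * of_real t * z) - (z * w)^2 * (2 * of_real \<alpha> * of_real e * z)
    + (z * w) * (of_real \<beta> * w\<^sup>2) - (z * w) * (of_real e * of_real t * z\<^sup>2)"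
    by (simp add: algebra_simps eval_nat_numeral)
  also have "\<dots> = of_real (t + 2 * \<alpha> * d - e * \<beta>) + of_real (2 * \<alpha> + d * \<beta>) * w
     + of_real (d * t - 2 * \<alpha> * e) * z + of_real \<beta> * w\<^sup>2 - of_real (e * t) * z\<^sup>2"
    unfolding zw by (simp add: algebra_simps)
  also have "Re \<dots> = t + 2 * \<alpha> * d - e * \<beta> + (2 * \<alpha> + d * t + d * \<beta> - 2 * \<alpha> * e) * Re z
     + (\<beta> - e * t) * Re (z\<^sup>2)"
    by (simp add: Re_w algebra_simps)
  finally show ?thesis
    using c1 c2 by (simp add: w_def)
qed

lemma cubic_flow_solution:
  assumes I: "is_interval I" "open I" "I \<noteq> {}" "I \<subseteq> {0<..}"
    and crit: "\<And>t k. t \<in> I \<Longrightarrow> 1 < cmod (crit k t)"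
  shows "locally_univalent_solution I (\<lambda>t. t + 2 * quad_coeff t * quad_coeff' t - 1 / t^4 * (1 / t^3)) cubic_flow"
    and "rational_derivative I cubic_flow 2 0 0 \<nu> (\<lambda>t. of_real (1 / t^3)) crit p"
proof -
  have pos: "t > 0" if "t \<in> I" for t using I that by auto
  have td: "tderiv I cubic_flow z t = z + of_real (quad_coeff' t) * z\<^sup>2 - of_real (1 / t^4) * z^3"
    if "t \<in> I" for z t
    unfolding tderiv_def at_within_open[OF that I(2)]
    by (rule vector_derivative_at) (rule cubic_flow_has_vector_derivative[OF pos[OF that]])
  have smooth: "smooth_in_time I cubic_flow"
    unfolding smooth_in_time_def
  proof (intro conjI ballI)
    show "(\<lambda>s. cubic_flow z s) differentiable at t within I" if "t \<in> I" for z t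
      using cubic_flow_has_vector_derivative[OF pos[OF that]] differentiableI_vector by blast
    have "continuous_on (cball 0 1 \<times> I) (\<lambda>x. quad_coeff' (snd x))"
      by (intro continuous_on_compose2[OF continuous_on_quad_coeff'[of UNIV]] continuous_intros) auto
    then have "continuous_on (cball 0 1 \<times> I)
        (\<lambda>x. fst x + complex_of_real (quad_coeff' (snd x)) * (fst x)\<^sup>2 - of_real (1 / (snd x)^4) * (fst x)^3)"
      by (intro continuous_intros) (auto dest: pos)
    then show "continuous_on (cball 0 1 \<times> I) (\<lambda>(z, t). tderiv I cubic_flow z t)"
      by (rule continuous_on_eq) (auto simp: td)
  qed
  show "locally_univalent_solution I (\<lambda>t. t + 2 * quad_coeff t * quad_coeff' t - 1 / t^4 * (1 / t^3)) cubic_flow"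
    unfolding locally_univalent_solution_def
  proof (intro conjI ballI smooth)
    show "is_interval I" "interior I \<noteq> {}" using I by (auto simp: interior_open)
    show "continuous_on I (\<lambda>t. t + 2 * quad_coeff t * quad_coeff' t - 1 / t^4 * (1 / t^3))"
      by (intro continuous_intros continuous_on_quad_coeff continuous_on_quad_coeff') (use pos in force)+
    fix t assume t: "t \<in> I"
    show "(\<lambda>z. cubic_flow z t) analytic_on cball 0 1"
      unfolding cubic_flow_def by (intro analytic_intros)
    show "cubic_flow 0 t = 0" by (simp add: cubic_flow_def)
    show "Im (deriv (\<lambda>z. cubic_flow z t) 0) = 0" "Re (deriv (\<lambda>z. cubic_flow z t) 0) > 0"
      using pos[OF t] by (simp_all add: deriv_cubic_flow)
    show "deriv (\<lambda>w. cubic_flow w t) z \<noteq> 0" if "z \<in> cball 0 1" for z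
      using that crit[OF t, of 1] crit[OF t, of 2] pos[OF t] by (auto simp: deriv_cubic_flow_factored)
    fix z :: complex assume z: "z \<in> sphere 0 1"
    show "Re (tderiv I cubic_flow z t * cnj (z * deriv (\<lambda>w. cubic_flow w t) z)) =
        t + 2 * quad_coeff t * quad_coeff' t - 1 / t^4 * (1 / t^3)"
      unfolding td[OF t] deriv_cubic_flow
    \<comment> \<open>The two conditions express that the two quantities conserved by the flow have
      derivative 0; \<open>q\<close> is the constant term that remains.\<close>
    proof (rule Polubarinova_Galin_cubic)
      show "cmod z = 1" using z by simp
      show "2 * quad_coeff t + quad_coeff' t * t + quad_coeff' t * (1 / t^3) - 2 * quad_coeff t * (1 / t^4) = 0"
        using quad_coeff_ode[OF pos[OF t]] by simp
      show "1 / t^3 = 1 / t^4 * t" using pos[OF t] by (simp add: eval_nat_numeral)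
    qed
  qed
  have two: "{Suc 0..2} = {Suc 0, 2}" by auto
  show "rational_derivative I cubic_flow 2 0 0 \<nu> (\<lambda>t. of_real (1 / t^3)) crit p"
    unfolding rational_derivative_def
    using crit pos I(4) by (auto simp: two rat_g_def deriv_cubic_flow_factored intro: continuous_on_crit)
qed

lemma crit_2: "crit k 2 = - 4"
proof -
  have "sqrt_disc 2 = 0" by (simp add: sqrt_disc_def disc_2 complex_eq_iff)
  then show ?thesis by (simp add: crit_def quad_coeff_def)
qed

text \<open>If \<open>crit 1\<close> were differentiable at the collision time, so would be \<open>sqrt_disc\<close>, which
  vanishes there; its square \<open>disc\<close> would then have derivative 0, but \<open>disc\<close> has a simple zero.\<close>

lemma crit_not_differentiable: "\<not> crit 1 differentiable (at 2)"
proof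
  assume "crit 1 differentiable (at 2)"
  then obtain D where D: "(crit 1 has_vector_derivative D) (at 2)"
    using vector_derivative_works by blast
  have b: "((\<lambda>s. of_real (quad_coeff s)) has_vector_derivative complex_of_real (quad_coeff' 2)) (at 2)"
    using quad_coeff_deriv[unfolded has_real_derivative_iff_has_vector_derivative]
    by (rule bounded_linear.has_vector_derivative[OF bounded_linear_of_real])
  have "((\<lambda>s. 1 / s^3) has_real_derivative - 3/16) (at 2)"
    by (auto intro!: derivative_eq_intros)
  from this[unfolded has_real_derivative_iff_has_vector_derivative]
  have c: "((\<lambda>s. of_real (1 / s^3)) has_vector_derivative complex_of_real (- 3/16)) (at 2)"
    by (rule bounded_linear.has_vector_derivative[OF bounded_linear_of_real])
  define \<sigma> where "\<sigma> = (\<lambda>s. of_real (1 / s^3) * crit 1 s + of_real (quad_coeff s))"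
  obtain E where E: "(\<sigma> has_vector_derivative E) (at 2)"
    unfolding \<sigma>_def using has_vector_derivative_add[OF has_vector_derivative_mult[OF c D] b] by blast
  have \<sigma>: "\<sigma> s = sqrt_disc s" if "s \<noteq> 0" for s
    using that by (simp add: \<sigma>_def crit_def)
  have "((\<lambda>s. \<sigma> s * \<sigma> s) has_vector_derivative \<sigma> 2 * E + E * \<sigma> 2) (at 2)"
    by (rule has_vector_derivative_mult[OF E E])
  moreover have "\<sigma> 2 = 0" by (simp add: \<sigma> sqrt_disc_def disc_2 complex_eq_iff)
  ultimately have "((\<lambda>s. \<sigma> s * \<sigma> s) has_vector_derivative 0) (at 2)" by simp
  then have "((\<lambda>s. complex_of_real (disc s)) has_vector_derivative 0) (at 2)"
  proof (rule has_vector_derivative_transform_within_open)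
    show "\<sigma> s * \<sigma> s = complex_of_real (disc s)" if "s \<in> {0<..}" for s
      using that by (simp add: \<sigma> power2_eq_square[symmetric] sqrt_disc_squared)
  qed auto
  moreover have "((\<lambda>s. complex_of_real (disc s)) has_vector_derivative complex_of_real (- 13/68)) (at 2)"
    using disc_deriv_2[unfolded has_real_derivative_iff_has_vector_derivative]
    by (rule bounded_linear.has_vector_derivative[OF bounded_linear_of_real])
  ultimately have "complex_of_real (- 13/68) = 0"
    using vector_derivative_unique_at by blast
  then show False by (simp add: complex_eq_iff)
qed

lemma multiple_zero_not_differentiable:
  "\<exists>(I :: real set) q f m n l \<nu> b \<omega> p t k.
     locally_univalent_solution I q f \<and> rational_derivative I f m n l \<nu> b \<omega> p \<and>
     t \<in> interior I \<and> k \<in> {1..m} \<and>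
     zorder (\<lambda>z. rat_g m n b \<omega> p z t) (\<omega> k t) > 1 \<and> \<not> (\<omega> k differentiable (at t))"
proof -
  \<comment> \<open>Both zeros are at \<open>-4\<close> at time 2, so by continuity they stay
    outside the closed disk for nearby times; the interval is chosen among these.\<close>
  have ev: "\<forall>\<^sub>F t in nhds 2. 1 < cmod (crit k t)" for k
  proof -
    have "isCont (crit k) 2"
      using continuous_on_crit[of "{0<..}" k] by (simp add: continuous_on_eq_continuous_at)
    then have "((\<lambda>t. cmod (crit k t)) \<longlongrightarrow> cmod (crit k 2)) (nhds 2)"
      by (intro tendsto_norm) (simp add: isCont_def tendsto_at_iff_tendsto_nhds)
    then show ?thesis
      by (rule order_tendstoD(1)) (simp add: crit_2)
  qed
  obtain S where S: "open S" "2 \<in> S" "\<And>t. t \<in> S \<Longrightarrow> 1 < cmod (crit 1 t) \<and> 1 < cmod (crit 2 t) \<and> t > 0"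
    using eventually_conj[OF ev[of 1] eventually_conj[OF ev[of 2] eventually_nhds_in_open[of "{0<..}" 2]]]
    unfolding eventually_nhds by auto
  have crit_other: "crit k = crit 2" if "k \<noteq> 1" for k
    using that by (auto simp: crit_def)
  obtain d where d: "d > 0" "ball 2 d \<subseteq> S" using S open_contains_ball by blast
  define I where "I = ball (2::real) d"
  have sol: "locally_univalent_solution I (\<lambda>t. t + 2 * quad_coeff t * quad_coeff' t - 1 / t^4 * (1 / t^3)) cubic_flow"
    and rd: "rational_derivative I cubic_flow 2 0 0 (\<lambda>_. 0) (\<lambda>t. of_real (1 / t^3)) crit (\<lambda>_ _. 0)"
  proof -
    have "is_interval I" "open I" "I \<noteq> {}" "I \<subseteq> {0<..}"
      using d S(3) by (auto simp: I_def is_interval_ball_real)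
    moreover have "1 < cmod (crit k t)" if "t \<in> I" for k t
    proof (cases "k = 1")
      case True
      then show ?thesis using S(3)[of t] that d(2) by (auto simp: I_def)
    next
      case False
      then show ?thesis using S(3)[of t] that d(2) crit_other[OF False] by (auto simp: I_def)
    qed
    ultimately show "locally_univalent_solution I (\<lambda>t. t + 2 * quad_coeff t * quad_coeff' t - 1 / t^4 * (1 / t^3)) cubic_flow"
      "rational_derivative I cubic_flow 2 0 0 (\<lambda>_. 0) (\<lambda>t. of_real (1 / t^3)) crit (\<lambda>_ _. 0)"
      by (intro cubic_flow_solution; blast)+
  qed
  have t: "2 \<in> I" using d by (simp add: I_def)
  then have "2 \<in> interior I" by (simp add: I_def interior_open)
  moreover have "zorder (\<lambda>z. rat_g 2 0 (\<lambda>t. of_real (1 / t^3)) crit (\<lambda>_ _. 0) z 2) (crit 1 2) > 1"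
  proof -
    have "{i\<in>{1..2}. crit i 2 = crit 1 2} = {1..2}" by (auto simp: crit_2)
    then show ?thesis using zorder_zero[OF sol rd t, of 1] by simp
  qed
  moreover have "(1::nat) \<in> {1..2}" by simp
  ultimately show ?thesis
    by (intro exI conjI) (rule sol, rule rd, assumption+, rule crit_not_differentiable)
qed

theorem theorem3p1:
  shows "(\<forall>(I :: real set) (q :: real \<Rightarrow> real) (f :: complex \<Rightarrow> real \<Rightarrow> complex)
           (m :: nat) (n :: nat) (l :: nat) (\<nu> :: nat \<Rightarrow> nat) (b :: real \<Rightarrow> complex)
           (\<omega> :: nat \<Rightarrow> real \<Rightarrow> complex) (p :: nat \<Rightarrow> real \<Rightarrow> complex)
           (t :: real) (R :: complex \<Rightarrow> complex) (g :: complex \<Rightarrow> complex).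
        locally_univalent_solution I q f \<longrightarrow>
        rational_derivative I f m n l \<nu> b \<omega> p \<longrightarrow>
        t \<in> I \<longrightarrow>
        rational_extension q f t R \<longrightarrow>
        g = (\<lambda>z. rat_g m n b \<omega> p z t) \<longrightarrow>
          (\<forall>k\<in>{1..m}. zorder g (\<omega> k t) = 1 \<longrightarrow>
             (\<omega> k has_vector_derivative - res_term R g (\<omega> k t)) (at t within I)) \<and>
          (\<forall>j\<in>{1..n}. zorder g (p j t) = - 1 \<longrightarrow>
             (p j has_vector_derivative res_term R g (p j t)) (at t within I)) \<and>
          (\<forall>k\<in>{1..m}. zorder g (\<omega> k t) > 1 \<longrightarrow>
             ((\<lambda>s. \<Sum>i\<in>{i\<in>{1..m}. \<omega> i t = \<omega> k t}. \<omega> i s) has_vector_derivative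
                - res_term R g (\<omega> k t)) (at t within I)) \<and>
          (\<forall>j\<in>{1..l}. \<exists>D. (p j has_vector_derivative D) (at t within I) \<and>
             of_nat (\<nu> j) * D = res_term R g (p j t)))
     \<and>
        (\<exists>(I :: real set) (q :: real \<Rightarrow> real) (f :: complex \<Rightarrow> real \<Rightarrow> complex)
           (m :: nat) (n :: nat) (l :: nat) (\<nu> :: nat \<Rightarrow> nat) (b :: real \<Rightarrow> complex)
           (\<omega> :: nat \<Rightarrow> real \<Rightarrow> complex) (p :: nat \<Rightarrow> real \<Rightarrow> complex) (t :: real) (k :: nat).
        locally_univalent_solution I q f \<and>
        rational_derivative I f m n l \<nu> b \<omega> p \<and>
        t \<in> interior I \<and>
        k \<in> {1..m} \<and>
        zorder (\<lambda>z. rat_g m n b \<omega> p z t) (\<omega> k t) > 1 \<and>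
        \<not> (\<omega> k differentiable (at t)))"
  by (rule conjI[OF _ multiple_zero_not_differentiable]) (intro allI impI, rule zeros_poles_evolution)

end
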